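(* Assume (H1), (H2), (H3). Fix $t>0$. Then: (i) the series $r(t,\infty,x)=\sum_{k\ge1}e^{-\lambda_kt}\psi_k(\infty)\psi_k(x)$ converges, and as $y\to\infty$, $r(t,y,\cdot)\to r(t,\infty,\cdot)$ in $L^p(\mu)$ for every $p\ge1$; in particular $r(t,\infty,\cdot)\in L^p(\mu)$ for all $p\ge1$ and it is a bounded continuous function; (ii) for every bounded measurable $f:\mathbb R_+\to\mathbb R$, $$\mathbb E\big(f(X^\infty_t);\mathbb T^{(\infty)}_0>t\big)=\int_0^\infty r(t,\infty,x)f(x)\,2e^{-\gamma(x)}dx,$$ i.e. $r(t,\infty,x)2e^{-\gamma(x)}dx$ is a density of $\mathbb P(X^\infty_t\in\cdot\,;\mathbb T^{(\infty)}_0>t)$; (iii) for every $p\ge1$ and $f\in L^p(\mu)$, $$\lim_{z\to\infty}\mathbb E\big(f(X^z_t);\mathbb T^{(z)}_0>t\big)=\mathbb E\big(f(X^\infty_t);\mathbb T^{(\infty)}_0>t\big)=\int_0^\infty r(t,\infty,x)f(x)\,2e^{-\gamma(x)}dx.$$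
   Context: Let $q\in C^1([0,\infty))$, $B$ a standard Brownian motion (law $\mathbb P$, expectation $\mathbb E$), $X^x$ the solution of $dX^x_t=dB_t-q(X^x_t)dt$, $X^x_0=x$, stopped at $0$, $\mathbb T^{(x)}_z=\inf\{t\ge0:X^x_t=z\}$. $\gamma(y)=2\int_0^yq$, $\mu(dx)=2e^{-\gamma(x)}dx$ on $[0,\infty)$, $\mathcal Lu=\frac12u''-qu'$. (H1): $\int_0^\infty e^{\gamma(y)}\int_y^\infty e^{-\gamma(\xi)}d\xi\,dy<\infty$. (H2): $q(x)\to\infty$ and $q'(x)/q(x)^2\to0$. (H3): there exist $a>0$, $x_0\ge0$ with $\inf\{q(y):y\ge x\}\ge a\,q(x)$ for all $x\ge x_0$. Under (H1), $X^\infty_t=\lim_{x\to\infty}X^x_{t\wedge\mathbb T^{(x)}_0}$ (a.s. monotone limit) and $\mathbb T^{(\infty)}_0=\lim_x\mathbb T^{(x)}_0$. Known spectral facts under (H1),(H2): the generator on $L^2(\mu)$ of $X$ killed at $0$ has purely discrete simple spectrum $-\lambda_1>-\lambda_2>\cdots$ with $0<\lambda_1<\lambda_2<\cdots$ and $L^2(\mu)$-orthonormal eigenfunctions $\psi_k\in C^2$, $\mathcal L\psi_k=-\lambda_k\psi_k$, $\psi_k(0)=0$; each $\psi_k$ is bounded with finite limit $\psi_k(\infty)$. For finite $y>0$, $\mathbb P(X^y_t\in dx,\mathbb T^{(y)}_0>t)=r(t,y,x)2e^{-\gamma(x)}dx$ with $r(t,y,x)=\sum_{k\ge1}e^{-\lambda_kt}\psi_k(y)\psi_k(x)$.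 *)

theory Defs
  imports "HOL-Probability.Probability"
begin

definition std_BM :: "'a measure \<Rightarrow> (real \<Rightarrow> 'a \<Rightarrow> real) \<Rightarrow> bool" where
  "std_BM M B \<longleftrightarrow> prob_space M
     \<and> (\<forall>t. B t \<in> borel_measurable M)
     \<and> (\<forall>\<omega>\<in>space M. B 0 \<omega> = 0 \<and> continuous_on {0..} (\<lambda>t. B t \<omega>))
     \<and> (\<forall>s t. 0 \<le> s \<longrightarrow> s < t \<longrightarrow>
          distributed M lborel (\<lambda>\<omega>. B t \<omega> - B s \<omega>)
            (\<lambda>x. ennreal (normal_density 0 (sqrt (t - s)) x)))
     \<and> (\<forall>(n::nat) (ts::nat \<Rightarrow> real). 0 \<le> ts 0 \<and> (\<forall>i<n. ts i < ts (Suc i)) \<longrightarrow>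
          prob_space.indep_vars M (\<lambda>_. borel) (\<lambda>i \<omega>. B (ts (Suc i)) \<omega> - B (ts i) \<omega>) {..<n})"

definition gam :: "(real \<Rightarrow> real) \<Rightarrow> real \<Rightarrow> real" where
  "gam q y = 2 * integral {0..y} q"

definition mu :: "(real \<Rightarrow> real) \<Rightarrow> real measure" where
  "mu q = density lborel (\<lambda>x. indicator {0..} x * ennreal (2 * exp (- gam q x)))"

definition hit0 :: "(real \<Rightarrow> real \<Rightarrow> 'a \<Rightarrow> real) \<Rightarrow> real \<Rightarrow> 'a \<Rightarrow> ereal" where
  "hit0 X x \<omega> = Inf {ereal s | s. 0 \<le> s \<and> X x s \<omega> = 0}"

(* r(t,y,x) = sum_{k>=1} e^{-lambda_k t} psi_k(y) psi_k(x); index k of lam/psi here is k+1 in the paper *)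
definition rker :: "(nat \<Rightarrow> real) \<Rightarrow> (nat \<Rightarrow> real \<Rightarrow> real) \<Rightarrow> real \<Rightarrow> real \<Rightarrow> real \<Rightarrow> real" where
  "rker lam psi t y x = (\<Sum>k. exp (- lam k * t) * psi k y * psi k x)"

definition psi_inf :: "(nat \<Rightarrow> real \<Rightarrow> real) \<Rightarrow> nat \<Rightarrow> real" where
  "psi_inf psi k = Lim at_top (psi k)"

definition rker_inf :: "(nat \<Rightarrow> real) \<Rightarrow> (nat \<Rightarrow> real \<Rightarrow> real) \<Rightarrow> real \<Rightarrow> real \<Rightarrow> real" where
  "rker_inf lam psi t x = (\<Sum>k. exp (- lam k * t) * psi_inf psi k * psi k x)"

end

(* Everything rests on the bound sup |psi_k| <= C_e exp(e lam_k) for every e > 0, together with the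
   summability of 1 / lam_k: the kernel series then converges uniformly on the half line, including at
   the starting point infinity.

   Sup bound. For an eigenfunction f with eigenvalue l, as long as q^2 is at most of order l, the energy
   f^2 + f'^2 / (2 l) has logarithmic derivative at most 4 q, hence of order l / q. Where q^2 >= 8 l,
   boundedness of f forces |f'| <= (2 l / q) |f|, since the set of (f, f') violating this is invariant
   and leads to unbounded growth; so f^2 again grows at rate of order l / q. By (H3) one point separates
   the two regimes, and by (H1), (H2) the integral of 1 / q over [y, oo) is small for large y.

   Trace bound. With p = exp (- gamma) f', boundedness of f gives p(z) = l * (integral of f over [z, oo)
   against mu), so Bessel's inequality for the indicators of [z, oo) integrated against exp gamma bounds
   the sum of 1 / lam_k by the integral in (H1).

   Law at infinity. The limiting hitting time has no atom at t, because the limits of the survival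
   probabilities are continuous in time; weak convergence then identifies the law of the limit process. *)
theory Submission
  imports Defs
begin

text \<open>The transition density is given for finite starting points only, and L^2 convergence of
  the expansion says nothing about the starting point infinity. Hence the search for a majorant that
  is uniform in both space variables. Since t > 0 may be arbitrarily small, the rate e in the sup
  bound must be too: all growth in l beyond a point y is gathered into exp (const * l * (integral of
  1 / q over [y, oo))), while on [0, y] the flux formula gives |f'| <= const * l, which is only
  polynomial in l. The equation f'' = 2 q f' - 2 l f has characteristic roots r with r^2 - 2 q r + 2
  l = 0. For large q^2 / l they are about l / q and 2 q; the slope 2 l / q is twice the slow root,
  and a bounded solution cannot follow the fast one. (H1) reaches 1 / q through the comparison 1 /
  q(x) <= 3/2 exp (gamma x) mu [x, oo). In the trace bound, 1 / l is written as l / l^2 and the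
  numerator is replaced by the Dirichlet energy of f. The sign of the kernel cannot be seen from its
  series; it is read off from the probabilities that the kernel represents.\<close>

section \<open>Growth of bounded solutions of the eigenvalue equation\<close>

lemma mvt_Icc:
  fixes F F' :: "real \<Rightarrow> real"
  assumes "a < b"
    and "\<And>x. a \<le> x \<Longrightarrow> x \<le> b \<Longrightarrow> (F has_real_derivative F' x) (at x within {a..b})"
  obtains x where "a < x" "x < b" "F b - F a = F' x * (b - a)"
proof -
  have "\<exists>x\<in>{a<..<b}. F b - F a = (\<lambda>h. F' x * h) (b - a)"
    using assms by (intro mvt_simple) (auto simp: has_field_derivative_def)
  then show ?thesis using that by auto
qed

text \<open>The integrating factor is exp (- c J). The rate enters through an antiderivative
  \<open>J\<close>, so that exponents from adjacent intervals add up; below,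
  \<open>J' = 1 / q\<close>.\<close>

lemma gronwall_real:
  fixes F F' J J' :: "real \<Rightarrow> real"
  assumes "a \<le> b"
    and F: "\<And>x. a \<le> x \<Longrightarrow> x \<le> b \<Longrightarrow> (F has_real_derivative F' x) (at x within {a..b})"
    and J: "\<And>x. a \<le> x \<Longrightarrow> x \<le> b \<Longrightarrow> (J has_real_derivative J' x) (at x within {a..b})"
    and le: "\<And>x. a < x \<Longrightarrow> x < b \<Longrightarrow> F' x \<le> c * J' x * F x"
  shows "F b \<le> F a * exp (c * (J b - J a))"
proof (cases "a = b")
  case False
  define G where "G x = F x * exp (- c * J x)" for x
  define G' where "G' x = exp (- c * J x) * (F' x - c * J' x * F x)" for x
  have "(G has_real_derivative G' x) (at x within {a..b})" if "a \<le> x" "x \<le> b" for x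
    unfolding G_def G'_def
    by (rule derivative_eq_intros F J that refl | simp add: algebra_simps)+
  with False \<open>a \<le> b\<close> obtain x where x: "a < x" "x < b" "G b - G a = G' x * (b - a)"
    using mvt_Icc[of a b G G'] by auto
  have "G' x \<le> 0" using le[OF x(1,2)] by (simp add: G'_def mult_le_0_iff)
  then have "G b \<le> G a" using x by (smt (verit) mult_nonpos_nonneg)
  then have "F b * exp (- c * J b) * exp (c * J b) \<le> F a * exp (- c * J a) * exp (c * J b)"
    by (simp add: G_def)
  then show ?thesis
    by (simp add: mult.assoc exp_add[symmetric] algebra_simps)
qed simp

text \<open>The sign of \<open>D'\<close> is known only where \<open>D\<close> is nonnegative, so
  monotonicity cannot be used outright: up to the first point with \<open>D <= 0\<close> the
  function does not decrease, hence that point cannot exist.\<close>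

lemma positive_barrier:
  fixes D D' :: "real \<Rightarrow> real"
  assumes "a \<le> b" "D a > 0"
    and D: "\<And>x. a \<le> x \<Longrightarrow> x \<le> b \<Longrightarrow> (D has_real_derivative D' x) (at x within {a..b})"
    and nonneg: "\<And>x. a < x \<Longrightarrow> x < b \<Longrightarrow> D x \<ge> 0 \<Longrightarrow> D' x \<ge> 0"
  shows "D a \<le> D b"
proof -
  have up: "D a \<le> D c" if "a \<le> c" "c \<le> b" and pos: "\<And>x. a < x \<Longrightarrow> x < c \<Longrightarrow> D x \<ge> 0" for c
  proof (cases "a = c")
    case False
    have "\<And>x. a \<le> x \<Longrightarrow> x \<le> c \<Longrightarrow> (D has_real_derivative D' x) (at x within {a..c})"
      using that by (auto intro: DERIV_subset[OF D])
    moreover have "a < c" using False that by simp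
    ultimately obtain x where x: "a < x" "x < c" "D c - D a = D' x * (c - a)"
      using mvt_Icc[of a c D D'] by blast
    then have "D' x \<ge> 0" using nonneg pos that by auto
    then show ?thesis using x that by (smt (verit) mult_nonneg_nonneg)
  qed simp
  have cont: "continuous_on {a..b} D" using D by (intro DERIV_continuous_on) auto
  define S where "S = {x\<in>{a..b}. D x \<le> 0}"
  have "S = {}"
  proof (rule ccontr)
    assume "S \<noteq> {}"
    have "closed S" unfolding S_def
      by (intro continuous_on_closed_Collect_le cont continuous_intros)
    moreover have "bdd_below S" unfolding S_def by (auto intro: bdd_belowI)
    ultimately have "Inf S \<in> S" using \<open>S \<noteq> {}\<close> closed_contains_Inf by auto
    moreover have "D x \<ge> 0" if "a < x" "x < Inf S" for x
    proof (rule ccontr)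
      assume "\<not> 0 \<le> D x"
      then have "x \<in> S" using that \<open>Inf S \<in> S\<close> by (auto simp: S_def)
      then show False using cInf_lower[OF _ \<open>bdd_below S\<close>] that by fastforce
    qed
    ultimately have "D a \<le> D (Inf S)" by (intro up) (auto simp: S_def)
    then show False using \<open>Inf S \<in> S\<close> \<open>D a > 0\<close> by (auto simp: S_def)
  qed
  then have "D x \<ge> 0" if "a < x" "x < b" for x
    using that unfolding S_def by (smt (verit) atLeastAtMost_iff empty_iff mem_Collect_eq)
  then show ?thesis using up[of b] \<open>a \<le> b\<close> by auto
qed

lemma steep_imp_unbounded:
  fixes F F' :: "real \<Rightarrow> real"
  assumes F: "\<And>x. a \<le> x \<Longrightarrow> (F has_real_derivative F' x) (at x within {a..})"
    and "c > 0" and steep: "\<And>x. a \<le> x \<Longrightarrow> c \<le> \<bar>F' x\<bar>"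
    and bound: "\<And>x. a \<le> x \<Longrightarrow> \<bar>F x\<bar> \<le> M"
  shows False
proof -
  \<comment> \<open>Chosen so that c * (b - a) = 2 M + 1 exceeds 2 M, the largest possible increment
    of \<open>F\<close>. One mean value point on [a, b] suffices, so \<open>F'\<close> may have
    either sign.\<close>
  define b where "b = a + (2 * M + 1) / c"
  have "M \<ge> 0" using bound[of a] by auto
  then have "a < b" using \<open>c > 0\<close> by (simp add: b_def)
  moreover have "\<And>x. a \<le> x \<Longrightarrow> x \<le> b \<Longrightarrow> (F has_real_derivative F' x) (at x within {a..b})"
    by (auto intro: DERIV_subset[OF F])
  ultimately obtain x where x: "a < x" "x < b" "F b - F a = F' x * (b - a)"
    using mvt_Icc[of a b F F'] by blast
  have "c * (b - a) \<le> \<bar>F' x\<bar> * (b - a)"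
    using steep[of x] x by (intro mult_right_mono) auto
  also have "\<dots> = \<bar>F b - F a\<bar>" using x by (simp add: abs_mult)
  also have "\<dots> \<le> 2 * M" using bound[of a] bound[of b] \<open>a < b\<close> by auto
  finally show False using \<open>c > 0\<close> by (simp add: b_def)
qed

text \<open>The region \<open>f'\<^sup>2 > (2 l / q)\<^sup>2 f\<^sup>2\<close> is forward invariant, and \<open>f'\<^sup>2\<close> stays bounded away from 0 in it.\<close>

lemma subsolution_slope:
  fixes q q' f df :: "real \<Rightarrow> real"
  assumes "l > 0"
    and q: "\<And>x. a \<le> x \<Longrightarrow> (q has_real_derivative q' x) (at x within {a..})"
    and f: "\<And>x. a \<le> x \<Longrightarrow> (f has_real_derivative df x) (at x within {a..})"
    and df: "\<And>x. a \<le> x \<Longrightarrow>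
      (df has_real_derivative 2 * q x * df x - 2 * l * f x) (at x within {a..})"
    and qpos: "\<And>x. a \<le> x \<Longrightarrow> 0 < q x"
    and q'_small: "\<And>x. a \<le> x \<Longrightarrow> \<bar>q' x\<bar> \<le> (q x)\<^sup>2 / 4"
    and q_large: "\<And>x. a \<le> x \<Longrightarrow> 8 * l \<le> (q x)\<^sup>2"
    and bound: "\<And>x. a \<le> x \<Longrightarrow> \<bar>f x\<bar> \<le> M"
  shows "\<bar>df a\<bar> \<le> 2 * l / q a * \<bar>f a\<bar>"
proof (rule ccontr)
  assume neg: "\<not> ?thesis"
  \<comment> \<open>\<open>w\<close> is the critical slope; \<open>D > 0\<close> means that |f'|
    exceeds w |f|.\<close>
  define w where "w x = 2 * l / q x" for x
  define D where "D x = (df x)\<^sup>2 - (w x)\<^sup>2 * (f x)\<^sup>2" for x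
  define D' where "D' x = 2 * df x * (2 * q x * df x - 2 * l * f x)
    - (2 * w x * (- 2 * l * q' x / (q x)\<^sup>2) * (f x)\<^sup>2 + (w x)\<^sup>2 * (2 * f x * df x))" for x
  have w_deriv: "(w has_real_derivative - 2 * l * q' x / (q x)\<^sup>2) (at x within {a..})" if "a \<le> x" for x
    unfolding w_def using qpos[OF that]
    by (auto intro!: derivative_eq_intros q that simp: power2_eq_square)
  have D: "(D has_real_derivative D' x) (at x within {a..})" if "a \<le> x" for x
    unfolding D_def D'_def
    by (rule derivative_eq_intros f df w_deriv that refl | simp)+
  have "D a > 0"
  proof -
    have "0 \<le> w a" using qpos[of a] \<open>l > 0\<close> by (simp add: w_def)
    then have "(w a * \<bar>f a\<bar>)\<^sup>2 < \<bar>df a\<bar>\<^sup>2"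
      using neg by (intro power_strict_mono mult_nonneg_nonneg) (auto simp: w_def)
    then show ?thesis by (simp add: D_def power_mult_distrib)
  qed
  \<comment> \<open>The leading term of \<open>D'\<close> is 4 q f'^2. The three error terms,
    estimated by |f'| >= w |f|, cost at most 2 q f'^2, q f'^2 / 2 and q f'^2 / 2.\<close>
  have D'_nonneg: "D' x \<ge> 0" if "a \<le> x" "D x \<ge> 0" for x
  proof -
    have w: "0 \<le> w x" using qpos[OF that(1)] \<open>l > 0\<close> by (simp add: w_def less_imp_le)
    have wq: "w x * q x = 2 * l" using qpos[of x] that by (simp add: w_def)
    \<comment> \<open>This is where 8 l <= q^2 enters; the bound on \<open>q'\<close> serves the
      third error term in the same way.\<close>
    have wle: "w x \<le> q x / 4"
      using q_large[OF that(1)] qpos[OF that(1)] by (simp add: w_def field_simps power2_eq_square)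
    have "(w x * \<bar>f x\<bar>)\<^sup>2 \<le> \<bar>df x\<bar>\<^sup>2" using that(2) by (simp add: D_def power_mult_distrib)
    then have wf: "w x * \<bar>f x\<bar> \<le> \<bar>df x\<bar>" by (rule power2_le_imp_le) simp
    have 1: "4 * l * (f x * df x) \<le> 2 * q x * (df x)\<^sup>2"
    proof -
      have "4 * l * (f x * df x) \<le> 4 * l * \<bar>f x * df x\<bar>" using \<open>l > 0\<close> by simp
      also have "\<dots> = 2 * (w x * q x) * (\<bar>f x\<bar> * \<bar>df x\<bar>)" by (simp add: wq abs_mult)
      also have "\<dots> = 2 * q x * (w x * \<bar>f x\<bar> * \<bar>df x\<bar>)" by simp
      also have "\<dots> \<le> 2 * q x * (\<bar>df x\<bar> * \<bar>df x\<bar>)"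
        using wf qpos[OF that(1)] by (intro mult_left_mono mult_right_mono) auto
      finally show ?thesis by (simp add: power2_eq_square)
    qed
    have 2: "(w x)\<^sup>2 * (2 * f x * df x) \<le> q x / 2 * (df x)\<^sup>2"
    proof -
      have "(w x)\<^sup>2 * (2 * f x * df x) \<le> 2 * w x * (w x * \<bar>f x\<bar> * \<bar>df x\<bar>)"
        using mult_left_mono[OF abs_ge_self[of "f x * df x"], of "2 * (w x)\<^sup>2"]
        by (simp add: power2_eq_square abs_mult algebra_simps)
      also have "\<dots> \<le> 2 * (q x / 4) * (\<bar>df x\<bar> * \<bar>df x\<bar>)"
        using wf wle w qpos[OF that(1)] by (intro mult_mono mult_right_mono) auto
      finally show ?thesis by (simp add: power2_eq_square)
    qed
    have 3: "2 * w x * (- 2 * l * q' x / (q x)\<^sup>2) * (f x)\<^sup>2 \<le> q x / 2 * (df x)\<^sup>2"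
    proof -
      have "2 * w x * (- 2 * l * q' x / (q x)\<^sup>2) * (f x)\<^sup>2 = 2 * (w x * \<bar>f x\<bar>)\<^sup>2 * (- q' x / q x)"
        unfolding power_mult_distrib power2_abs
        using qpos[OF that(1)] by (simp add: w_def power2_eq_square mult_ac)
      also have "\<dots> \<le> 2 * (w x * \<bar>f x\<bar>)\<^sup>2 * (q x / 4)"
      proof (intro mult_left_mono)
        show "- q' x / q x \<le> q x / 4"
          using q'_small[OF that(1)] qpos[OF that(1)] by (simp add: field_simps power2_eq_square)
      qed simp
      also have "\<dots> \<le> 2 * \<bar>df x\<bar>\<^sup>2 * (q x / 4)"
        using wf w qpos[OF that(1)] by (intro mult_left_mono mult_right_mono power_mono) auto
      finally show ?thesis by simp
    qed
    have "D' x = 4 * q x * (df x)\<^sup>2 - 4 * l * (f x * df x)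
        - 2 * w x * (- 2 * l * q' x / (q x)\<^sup>2) * (f x)\<^sup>2 - (w x)\<^sup>2 * (2 * f x * df x)"
      by (simp add: D'_def algebra_simps power2_eq_square)
    moreover have "q x * (df x)\<^sup>2 \<ge> 0" using qpos[OF that(1)] by simp
    ultimately show ?thesis using 1 2 3 by (simp add: algebra_simps)
  qed
  \<comment> \<open>From here on f'^2 >= D >= D a > 0, so the slope of the bounded function
    \<open>f\<close> stays away from 0.\<close>
  have "D a \<le> D b" if "a \<le> b" for b
    using that \<open>D a > 0\<close> D'_nonneg
    by (intro positive_barrier[of a b D D']) (auto intro: DERIV_subset[OF D])
  then have "D a \<le> (df x)\<^sup>2" if "a \<le> x" for x
    using that by (smt (verit) D_def mult_nonneg_nonneg zero_le_power2)
  then have "sqrt (D a) \<le> \<bar>df x\<bar>" if "a \<le> x" for x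
    using that real_le_rsqrt[of "D a"] by (metis real_sqrt_abs real_sqrt_le_mono)
  then show False
    using steep_imp_unbounded[OF f _ _ bound, where c = "sqrt (D a)"] \<open>D a > 0\<close> by auto
qed

text \<open>Both regimes have logarithmic growth rate at most 32 l / (c^2 q), so the two Gronwall
  estimates multiply to a single exponential in \<open>J z - J y\<close>, wherever the switching
  point lies. That point depends on l, the bound does not mention it.\<close>

lemma eigenfunction_growth:
  fixes q q' f df J :: "real \<Rightarrow> real"
  assumes "l > 0" "0 < c"
    and q: "\<And>x. y \<le> x \<Longrightarrow> (q has_real_derivative q' x) (at x within {y..})"
    and f: "\<And>x. y \<le> x \<Longrightarrow> (f has_real_derivative df x) (at x within {y..})"
    and df: "\<And>x. y \<le> x \<Longrightarrow>
      (df has_real_derivative 2 * q x * df x - 2 * l * f x) (at x within {y..})"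
    and J: "\<And>x. y \<le> x \<Longrightarrow> (J has_real_derivative 1 / q x) (at x within {y..})"
    and qpos: "\<And>x. y \<le> x \<Longrightarrow> 0 < q x"
    and q'_small: "\<And>x. y \<le> x \<Longrightarrow> \<bar>q' x\<bar> \<le> (q x)\<^sup>2 / 4"
    and q_quasi_mono: "\<And>x z. y \<le> x \<Longrightarrow> x \<le> z \<Longrightarrow> c * q x \<le> q z"
    and q_lim: "filterlim q at_top at_top"
    and bound: "\<And>x. y \<le> x \<Longrightarrow> \<bar>f x\<bar> \<le> M"
    and "y \<le> z"
  shows "(f z)\<^sup>2 \<le> ((f y)\<^sup>2 + (df y)\<^sup>2 / (2 * l)) * exp (32 * l / c\<^sup>2 * (J z - J y))"
proof -
  have "c \<le> 1" using q_quasi_mono[of y y] qpos[of y] by simp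
  then have c2: "c\<^sup>2 \<le> 1" using \<open>0 < c\<close> by (simp add: power_le_one)
  \<comment> \<open>The last point of \<open>S\<close> is the switching point. Quasi-monotonicity
    carries q^2 <= 8 l from there back to all earlier points, at the price of the factor 1 / c^2; if
    \<open>S\<close> is empty there is no low regime.\<close>
  define S where "S = {x\<in>{y..}. (q x)\<^sup>2 \<le> 8 * l}"
  obtain x\<^sub>0 where x0: "y \<le> x\<^sub>0"
    and low: "\<And>x. y \<le> x \<Longrightarrow> x < x\<^sub>0 \<Longrightarrow> (q x)\<^sup>2 \<le> 8 * l / c\<^sup>2"
    and high: "\<And>x. x\<^sub>0 < x \<Longrightarrow> 8 * l \<le> (q x)\<^sup>2"
  proof (cases "S = {}")
    case True
    then have "8 * l \<le> (q x)\<^sup>2" if "y < x" for x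
      using that by (auto simp: S_def dest: spec[of _ x])
    then show ?thesis using that[of y] by auto
  next
    case False
    \<comment> \<open>As 8 l + 1 >= 1, its square already exceeds 8 l, which bounds \<open>S\<close>
      from above.\<close>
    have "eventually (\<lambda>x. 8 * l + 1 \<le> q x) at_top"
      using q_lim by (simp add: filterlim_at_top)
    then obtain N where N: "\<And>x. x \<ge> N \<Longrightarrow> 8 * l + 1 \<le> q x" by (auto simp: eventually_at_top_linorder)
    have up: "x \<le> N" if "x \<in> S" for x
    proof (rule ccontr)
      assume "\<not> x \<le> N"
      then have "8 * l + 1 \<le> q x" using N by auto
      then have "(8 * l + 1) * 1 \<le> q x * q x" using \<open>l > 0\<close> by (intro mult_mono) auto
      then show False using that by (simp add: S_def power2_eq_square)
    qed
    then have bdd: "bdd_above S" by (auto simp: bdd_above_def)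
    have "continuous_on {y..} q" using q by (intro DERIV_continuous_on) auto
    then have "closed S" unfolding S_def
      by (intro continuous_on_closed_Collect_le continuous_intros) auto
    then have SupS: "Sup S \<in> S" using False bdd closed_contains_Sup by auto
    show ?thesis
    proof (rule that[of "Sup S"])
      show "y \<le> Sup S" using SupS by (simp add: S_def)
      fix x assume x: "y \<le> x" "x < Sup S"
      have "(c * q x)\<^sup>2 \<le> (q (Sup S))\<^sup>2"
        using q_quasi_mono[of x "Sup S"] x qpos[of x] \<open>0 < c\<close> by (intro power_mono) auto
      also have "\<dots> \<le> 8 * l" using SupS by (simp add: S_def)
      finally show "(q x)\<^sup>2 \<le> 8 * l / c\<^sup>2" using \<open>0 < c\<close> by (simp add: field_simps)
    next
      fix x assume "Sup S < x"
      then have "x \<notin> S" using cSup_upper[OF _ bdd] by force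
      then show "8 * l \<le> (q x)\<^sup>2" using SupS \<open>Sup S < x\<close> by (auto simp: S_def)
    qed
  qed
  \<comment> \<open>From q^2 <= 8 l / c^2 follows 4 q <= 32 l / (c^2 q).\<close>
  let ?k = "32 * l / c\<^sup>2"
  \<comment> \<open>The weight 1 / (2 l) makes the mixed terms f f' cancel, leaving F' = 4 q * f'^2
    / (2 l).\<close>
  define F where "F x = (f x)\<^sup>2 + (df x)\<^sup>2 / (2 * l)" for x
  define F' where "F' x = 2 * q x * (df x)\<^sup>2 / l" for x
  have F: "(F has_real_derivative F' x) (at x within {y..})" if "y \<le> x" for x
  proof -
    have "(F has_real_derivative
        2 * f x * df x + 2 * df x * (2 * q x * df x - 2 * l * f x) / (2 * l)) (at x within {y..})"
      unfolding F_def using \<open>l > 0\<close>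
      by (auto intro!: derivative_eq_intros f df that)
    also have "2 * f x * df x + 2 * df x * (2 * q x * df x - 2 * l * f x) / (2 * l) = F' x"
      using \<open>l > 0\<close> by (simp add: F'_def field_simps power2_eq_square)
    finally show ?thesis .
  qed
  have f_le_F: "(f x)\<^sup>2 \<le> F x" for x using \<open>l > 0\<close> by (simp add: F_def)
  have low_growth: "F x \<le> F y * exp (?k * (J x - J y))" if "y \<le> x" "x \<le> x\<^sub>0" for x
  proof (rule gronwall_real[where F' = F' and J' = "\<lambda>x. 1 / q x"])
    fix u assume u: "y < u" "u < x"
    have "q u \<le> 8 * l / c\<^sup>2 / q u"
      using divide_right_mono[OF low[of u], of "q u"] qpos[of u] u that
      by (simp add: power2_eq_square)
    then have "4 * q u \<le> ?k * (1 / q u)" by simp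
    moreover have "F' u \<le> 4 * q u * F u"
    proof -
      have "F' u = 4 * q u * ((df u)\<^sup>2 / (2 * l))" by (simp add: F'_def)
      also have "\<dots> \<le> 4 * q u * F u" using qpos[of u] u by (intro mult_left_mono) (auto simp: F_def)
      finally show ?thesis .
    qed
    moreover have "F u \<ge> 0" using \<open>l > 0\<close> by (simp add: F_def)
    ultimately show "F' u \<le> ?k * (1 / q u) * F u" by (meson mult_right_mono order_trans)
  qed (use that in \<open>auto intro: DERIV_subset[OF F] DERIV_subset[OF J]\<close>)
  show ?thesis
  proof (cases "z \<le> x\<^sub>0")
    case True
    then show ?thesis using low_growth[of z] f_le_F[of z] \<open>y \<le> z\<close> by (auto simp: F_def)
  next
    case False
    \<comment> \<open>Beyond the switching point the slope bound applies from every x, giving (f^2)'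
      <= (4 l / q) f^2, and 4 l <= \<open>?k\<close> because c <= 1.\<close>
    have "(f z)\<^sup>2 \<le> (f x\<^sub>0)\<^sup>2 * exp (?k * (J z - J x\<^sub>0))"
    proof (rule gronwall_real[where F' = "\<lambda>x. 2 * f x * df x" and J' = "\<lambda>x. 1 / q x"])
      show "((\<lambda>x. (f x)\<^sup>2) has_real_derivative 2 * f x * df x) (at x within {x\<^sub>0..z})"
        if "x\<^sub>0 \<le> x" "x \<le> z" for x
      proof -
        have "((\<lambda>x. (f x)\<^sup>2) has_real_derivative 2 * f x * df x) (at x within {y..})"
          using that x0 by (auto intro!: derivative_eq_intros f)
        then show ?thesis using x0 by (auto intro: DERIV_subset)
      qed
      fix x assume x: "x\<^sub>0 < x" "x < z"
      have "\<bar>df x\<bar> \<le> 2 * l / q x * \<bar>f x\<bar>"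
      proof (rule subsolution_slope[where q' = q' and M = M and a = x])
        show "\<bar>q' u\<bar> \<le> (q u)\<^sup>2 / 4" if "x \<le> u" for u
          using that x x0 by (intro q'_small) auto
      qed (use x x0 \<open>l > 0\<close> in
          \<open>auto intro: DERIV_subset[OF q] DERIV_subset[OF f] DERIV_subset[OF df] qpos high bound\<close>)
      then have "2 * \<bar>f x\<bar> * \<bar>df x\<bar> \<le> 2 * \<bar>f x\<bar> * (2 * l / q x * \<bar>f x\<bar>)"
        by (intro mult_left_mono) auto
      moreover have "2 * f x * df x \<le> 2 * \<bar>f x\<bar> * \<bar>df x\<bar>"
        using abs_ge_self[of "f x * df x"] by (simp add: abs_mult)
      moreover have "2 * \<bar>f x\<bar> * (2 * l / q x * \<bar>f x\<bar>) = 4 * l * (1 / q x) * (f x)\<^sup>2"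
        by (simp add: power2_eq_square)
      moreover have "4 * l * (1 / q x) * (f x)\<^sup>2 \<le> ?k * (1 / q x) * (f x)\<^sup>2"
      proof (intro mult_right_mono)
        show "4 * l \<le> ?k" using c2 \<open>0 < c\<close> \<open>l > 0\<close>
          by (simp add: field_simps)
      qed (use qpos[of x] x x0 in auto)
      ultimately show "2 * f x * df x \<le> ?k * (1 / q x) * (f x)\<^sup>2" by linarith
    qed (use False x0 in \<open>auto intro: DERIV_subset[OF J]\<close>)
    also have "\<dots> \<le> (F y * exp (?k * (J x\<^sub>0 - J y))) * exp (?k * (J z - J x\<^sub>0))"
      using low_growth[of x\<^sub>0] f_le_F[of "x\<^sub>0"] x0 by (intro mult_right_mono) auto
    also have "\<dots> = F y * exp (?k * (J z - J y))"
      unfolding mult.assoc[of "F y"] exp_add[symmetric] distrib_left[symmetric] by simp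
    finally show ?thesis by (simp add: F_def)
  qed
qed

section \<open>The speed measure and the integral of the inverse drift\<close>

lemma has_real_derivative_integral_atLeast:
  fixes g :: "real \<Rightarrow> real"
  assumes "continuous_on {a..} g" "a \<le> x"
  shows "((\<lambda>x. integral {a..x} g) has_real_derivative g x) (at x within {a..})"
proof -
  have "at x within {a..x+1} = at x within {a..}"
    by (rule at_within_nhd[of x "{..<x+1}"]) auto
  moreover have "continuous_on {a..x+1} g"
    by (rule continuous_on_subset[OF assms(1)]) auto
  ultimately show ?thesis
    using integral_has_real_derivative[of a "x+1" g x] \<open>a \<le> x\<close> by simp
qed

locale entrance_drift =
  fixes q q' :: "real \<Rightarrow> real"
  assumes q_deriv: "\<And>x. 0 \<le> x \<Longrightarrow> (q has_real_derivative q' x) (at x within {0..})"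
    and q'_cont: "continuous_on {0..} q'"
    and H1: "(\<integral>\<^sup>+ y. indicator {0..} y * ennreal (exp (gam q y)) *
               (\<integral>\<^sup>+ \<xi>. indicator {y..} \<xi> * ennreal (exp (- gam q \<xi>)) \<partial>lborel) \<partial>lborel) < \<infinity>"
    and H2a: "filterlim q at_top at_top"
    and H2b: "((\<lambda>x. q' x / (q x)\<^sup>2) \<longlongrightarrow> 0) at_top"
    and H3: "\<exists>a>0. \<exists>x0\<ge>0. \<forall>x\<ge>x0. a * q x \<le> Inf (q ` {x..})"
begin

lemma q_cont: "continuous_on {0..} q"
  using q_deriv by (intro DERIV_continuous_on) auto

lemma gam_deriv: "0 \<le> x \<Longrightarrow> (gam q has_real_derivative 2 * q x) (at x within {0..})"
  unfolding gam_def[abs_def]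
  by (intro DERIV_cmult has_real_derivative_integral_atLeast q_cont)

lemma gam_cont: "continuous_on {0..} (gam q)"
  using gam_deriv by (intro DERIV_continuous_on) auto

lemma gam_measurable [measurable]: "gam q \<in> borel_measurable borel"
proof -
  \<comment> \<open>For y < 0 the interval {0..y} is empty and \<open>gam q y\<close> is 0.\<close>
  have "gam q = (\<lambda>y. gam q (max 0 y))"
    by (auto simp: gam_def max_def fun_eq_iff)
  also have "\<dots> \<in> borel_measurable borel"
    by (intro borel_measurable_continuous_onI continuous_on_compose2[OF gam_cont] continuous_intros) auto
  finally show ?thesis .
qed

lemma mu_eq: "mu q = density lborel (\<lambda>x. ennreal (indicator {0..} x * (2 * exp (- gam q x))))"
  unfolding mu_def by (intro arg_cong2[where f = density] refl) (auto split: split_indicator)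

lemma sets_mu [simp, measurable_cong]: "sets (mu q) = sets borel"
  by (simp add: mu_def)

lemma space_mu [simp]: "space (mu q) = UNIV"
  by (simp add: mu_def)

lemma AE_mu_nonneg: "AE x in mu q. 0 \<le> x"
  unfolding mu_eq by (subst AE_density) (auto split: split_indicator)

lemma nn_integral_mu:
  assumes [measurable]: "f \<in> borel_measurable borel"
  shows "(\<integral>\<^sup>+ x. f x \<partial>mu q)
    = (\<integral>\<^sup>+ x. ennreal (indicator {0..} x * (2 * exp (- gam q x))) * f x \<partial>lborel)"
  unfolding mu_eq by (subst nn_integral_density) auto

text \<open>The fundamental theorem of calculus relative to \<open>mu q\<close>: the derivative of
  \<open>F\<close> carries the density 2 exp (- gamma). The integrations by parts below are
  instances with different \<open>F\<close>.\<close>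

lemma
  fixes F f :: "real \<Rightarrow> real"
  assumes "0 \<le> a" "a \<le> b"
    and F: "\<And>x. a \<le> x \<Longrightarrow> x \<le> b \<Longrightarrow>
      (F has_real_derivative 2 * exp (- gam q x) * f x) (at x within {a..b})"
    and f: "continuous_on {a..b} f"
  shows integrable_mu_Icc: "integrable (mu q) (\<lambda>x. indicator {a..b} x * f x)"
    and integral_mu_Icc: "(\<integral>x. indicator {a..b} x * f x \<partial>mu q) = F b - F a"
proof -
  have meas [measurable]: "(\<lambda>x. indicator {a..b} x * f x) \<in> borel_measurable borel"
    using borel_measurable_continuous_on_indicator[OF _ f] by simp
  have eq: "(indicator {0..} x * (2 * exp (- gam q x))) *\<^sub>R (indicator {a..b} x * f x)
      = indicator {a..b} x *\<^sub>R (2 * exp (- gam q x) * f x)" for x :: real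
    using \<open>0 \<le> a\<close> by (auto split: split_indicator)
  have "has_bochner_integral lborel
      (\<lambda>x. indicator {a..b} x *\<^sub>R (2 * exp (- gam q x) * f x)) (F b - F a)"
  proof (rule has_bochner_integral_FTC_Icc)
    show "continuous_on {a..b} (\<lambda>x. 2 * exp (- gam q x) * f x)"
      using \<open>0 \<le> a\<close> by (intro continuous_intros f continuous_on_subset[OF gam_cont]) auto
  qed (use \<open>a \<le> b\<close> F in \<open>auto simp: has_real_derivative_iff_has_vector_derivative\<close>)
  note * = this[folded eq]
  show "integrable (mu q) (\<lambda>x. indicator {a..b} x * f x)"
    unfolding mu_eq using * by (subst integrable_density) (auto simp: has_bochner_integral_iff)
  show "(\<integral>x. indicator {a..b} x * f x \<partial>mu q) = F b - F a"
    unfolding mu_eq using * by (subst integral_density) (auto simp: has_bochner_integral_iff)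
qed

lemma emeasure_mu_atLeast:
  assumes "0 \<le> y"
  shows "emeasure (mu q) {y..} = 2 * (\<integral>\<^sup>+ \<xi>. indicator {y..} \<xi> * ennreal (exp (- gam q \<xi>)) \<partial>lborel)"
proof -
  have "emeasure (mu q) {y..} = (\<integral>\<^sup>+ x. indicator {y..} x \<partial>mu q)"
    by simp
  also have "\<dots> = (\<integral>\<^sup>+ x. 2 * (indicator {y..} x * ennreal (exp (- gam q x))) \<partial>lborel)"
    using assms by (subst nn_integral_mu)
      (auto intro!: nn_integral_cong split: split_indicator simp: ennreal_mult')
  also have "\<dots> = 2 * (\<integral>\<^sup>+ x. indicator {y..} x * ennreal (exp (- gam q x)) \<partial>lborel)"
    by (intro nn_integral_cmult) measurable
  finally show ?thesis .
qed

lemma tail_measurable [measurable]: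
  "(\<lambda>y. \<integral>\<^sup>+ \<xi>. indicator {y..} \<xi> * ennreal (exp (- gam q \<xi>)) \<partial>lborel) \<in> borel_measurable borel"
proof -
  have "(\<lambda>(y, \<xi>). (if y \<le> \<xi> then 1 else 0) * ennreal (exp (- gam q \<xi>)))
      \<in> borel_measurable (borel \<Otimes>\<^sub>M lborel)"
    by measurable
  then show ?thesis
    by (intro lborel.borel_measurable_nn_integral) (simp add: indicator_def case_prod_beta')
qed

text \<open>Finiteness in (H1) makes the inner tail integral finite for almost every y >= 0, hence
  for some y in [0, 1]; the mass of [0, y] is finite by continuity.\<close>

lemma finite_measure_mu: "finite_measure (mu q)"
proof
  let ?h = "\<lambda>y. \<integral>\<^sup>+ \<xi>. indicator {y..} \<xi> * ennreal (exp (- gam q \<xi>)) \<partial>lborel"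
  have ae: "AE y in lborel. indicator {0..} y * ennreal (exp (gam q y)) * ?h y \<noteq> \<infinity>"
    using H1 by (intro nn_integral_noteq_infinite) auto
  have "\<exists>y. y \<in> {0..1} \<and> ?h y \<noteq> \<infinity>"
  proof (rule ccontr)
    assume neg: "\<not> ?thesis"
    have "AE y in lborel. y \<notin> {0..1::real}"
      using ae by eventually_elim (use neg in \<open>auto simp: ennreal_mult_top\<close>)
    then have "emeasure lborel {0..1::real} = 0"
      by (subst (asm) AE_iff_measurable[of "{0..1}"]) auto
    then show False by simp
  qed
  then obtain y where y: "0 \<le> y" "?h y \<noteq> \<infinity>" by auto
  then have up: "emeasure (mu q) {y..} \<noteq> \<infinity>"
    by (auto simp: emeasure_mu_atLeast ennreal_mult_eq_top_iff)
  have "continuous_on {0..} (\<lambda>x. 2 * exp (- gam q x))" by (intro continuous_intros gam_cont)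
  then have "\<exists>F. \<forall>x\<ge>0. (F has_real_derivative 2 * exp (- gam q x)) (at x within {0..})"
    using has_real_derivative_integral_atLeast by blast
  then obtain F where F: "\<And>x. 0 \<le> x \<Longrightarrow> (F has_real_derivative 2 * exp (- gam q x)) (at x within {0..})"
    by blast
  have "integrable (mu q) (\<lambda>x. indicator {0..y} x * (1::real))"
    using y by (intro integrable_mu_Icc[where F = F]) (auto intro: DERIV_subset[OF F])
  then have low: "emeasure (mu q) {0..y} \<noteq> \<infinity>"
    by (simp add: integrable_indicator_iff)
  have neg: "emeasure (mu q) {..<0} = 0"
    using AE_mu_nonneg by (subst (asm) AE_iff_measurable[of "{..<0}"]) auto
  have "emeasure (mu q) UNIV = emeasure (mu q) ({..<0} \<union> {0..y} \<union> {y..})"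
    using y by (intro arg_cong[where f = "emeasure (mu q)"]) auto
  also have "\<dots> \<le> emeasure (mu q) {..<0} + emeasure (mu q) {0..y} + emeasure (mu q) {y..}"
    by (intro order_trans[OF emeasure_subadditive] add_mono emeasure_subadditive) auto
  also have "\<dots> < \<infinity>" using up low neg by (simp add: less_top)
  finally show "emeasure (mu q) (space (mu q)) \<noteq> \<infinity>" by simp
qed

sublocale finite_measure "mu q" by (rule finite_measure_mu)

lemma tail_real_measurable [measurable]: "(\<lambda>y. measure (mu q) {y..}) \<in> borel_measurable borel"
proof -
  have "mono (\<lambda>y. - measure (mu q) {y..})"
    by (intro monoI) (auto intro!: finite_measure_mono)
  then have "(\<lambda>y. - measure (mu q) {y..}) \<in> borel_measurable borel"
    by (rule borel_measurable_mono)
  then show ?thesis by simp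
qed

text \<open>The integral of (H1), doubled because \<open>mu q\<close> carries a factor 2. It bounds
  both the integral of 1 / q near infinity and the sum of the inverse eigenvalues.\<close>

lemma integrable_exp_gam_tail:
  "integrable lborel (\<lambda>y. indicator {0..} y * (exp (gam q y) * measure (mu q) {y..}))"
proof (rule integrableI_bounded)
  let ?h = "\<lambda>y. \<integral>\<^sup>+ \<xi>. indicator {y..} \<xi> * ennreal (exp (- gam q \<xi>)) \<partial>lborel"
  have "(\<integral>\<^sup>+ y. ennreal (norm (indicator {0..} y * (exp (gam q y) * measure (mu q) {y..}))) \<partial>lborel)
      = (\<integral>\<^sup>+ y. 2 * (indicator {0..} y * ennreal (exp (gam q y)) * ?h y) \<partial>lborel)"
  proof (intro nn_integral_cong)
    fix y :: real
    show "ennreal (norm (indicator {0..} y * (exp (gam q y) * measure (mu q) {y..})))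
        = 2 * (indicator {0..} y * ennreal (exp (gam q y)) * ?h y)"
      using emeasure_mu_atLeast[of y, unfolded emeasure_eq_measure]
      by (auto split: split_indicator simp: ennreal_mult' mult_ac)
  qed
  also have "\<dots> = 2 * (\<integral>\<^sup>+ y. (indicator {0..} y * ennreal (exp (gam q y)) * ?h y) \<partial>lborel)"
    by (intro nn_integral_cmult) measurable
  also have "\<dots> < \<infinity>" using H1 by (simp add: ennreal_mult_less_top)
  finally show "(\<integral>\<^sup>+ y. ennreal (norm (indicator {0..} y *
      (exp (gam q y) * measure (mu q) {y..}))) \<partial>lborel) < \<infinity>" .
qed measurable

section \<open>The drift near infinity\<close>

lemma eventually_drift_bounds:
  obtains N where "0 \<le> N" "\<And>x. N \<le> x \<Longrightarrow> 1 \<le> q x" "\<And>x. N \<le> x \<Longrightarrow> \<bar>q' x\<bar> \<le> (q x)\<^sup>2 / 4"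
proof -
  have "eventually (\<lambda>x. \<bar>q' x / (q x)\<^sup>2\<bar> < 1/4) at_top"
    using tendstoD[OF H2b, of "1/4"] by (simp add: dist_real_def)
  moreover have "eventually (\<lambda>x. 1 \<le> q x) at_top"
    using H2a by (simp add: filterlim_at_top)
  ultimately have "eventually (\<lambda>x. 1 \<le> q x \<and> \<bar>q' x\<bar> \<le> (q x)\<^sup>2 / 4) at_top"
    by eventually_elim (auto simp: field_simps)
  then obtain N where "\<And>x. N \<le> x \<Longrightarrow> 1 \<le> q x \<and> \<bar>q' x\<bar> \<le> (q x)\<^sup>2 / 4"
    by (auto simp: eventually_at_top_linorder)
  then show ?thesis by (intro that[of "max 0 N"]) auto
qed

lemma exp_neg_gam_mono:
  assumes "0 \<le> N" "\<And>x. N \<le> x \<Longrightarrow> 0 \<le> q x" "N \<le> x" "x \<le> z"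
  shows "exp (- gam q z) \<le> exp (- gam q x)"
proof (cases "x = z")
  case False
  have "\<And>u. x \<le> u \<Longrightarrow> u \<le> z \<Longrightarrow> (gam q has_real_derivative 2 * q u) (at u within {x..z})"
    using assms by (auto intro: DERIV_subset[OF gam_deriv])
  moreover have "x < z" using False assms by simp
  ultimately obtain u where "x < u" "u < z" "gam q z - gam q x = 2 * q u * (z - x)"
    using mvt_Icc[of x z "gam q" "\<lambda>u. 2 * q u"] by blast
  moreover have "0 \<le> q u" using \<open>x < u\<close> assms by auto
  ultimately have "0 \<le> gam q z - gam q x" using \<open>x < z\<close> by simp
  then show ?thesis by simp
qed simp

text \<open>By (H2), the derivative of \<open>exp (- gam q) / q\<close> is at least \<open>- 3 exp (- gam q)\<close>.\<close>

lemma inverse_drift_le_tail: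
  assumes N: "0 \<le> N" "\<And>x. N \<le> x \<Longrightarrow> 1 \<le> q x" "\<And>x. N \<le> x \<Longrightarrow> \<bar>q' x\<bar> \<le> (q x)\<^sup>2 / 4"
    and x: "N \<le> x"
  shows "1 / q x \<le> 3 / 2 * (exp (gam q x) * measure (mu q) {x..})"
proof -
  \<comment> \<open>\<open>g\<close> is the derivative of \<open>w\<close> relative to the density 2
    exp (- gamma), so that differences of \<open>w\<close> are integrals of \<open>g\<close> against
    \<open>mu q\<close>.\<close>
  define w where "w u = exp (- gam q u) / q u" for u
  define g where "g u = - (1 + q' u / (q u)\<^sup>2 / 2)" for u
  have w: "(w has_real_derivative 2 * exp (- gam q u) * g u) (at u within {0..})" if "N \<le> u" for u
  proof -
    have "q u > 0" using N(2)[OF that] by simp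
    then have "(w has_real_derivative
        (exp (- gam q u) * (- (2 * q u)) * q u - exp (- gam q u) * q' u) / (q u * q u)) (at u within {0..})"
      unfolding w_def using that N(1)
      by (auto intro!: derivative_eq_intros gam_deriv q_deriv)
    moreover have "(exp (- gam q u) * (- (2 * q u)) * q u - exp (- gam q u) * q' u) / (q u * q u)
        = 2 * exp (- gam q u) * g u"
      using \<open>q u > 0\<close> by (simp add: g_def field_simps power2_eq_square)
    ultimately show ?thesis by simp
  qed
  \<comment> \<open>The hypothesis on \<open>q'\<close> would even give - 9/8; - 3/2 is a round
    value.\<close>
  have g_ge: "- (3 / 2) \<le> g u" if "N \<le> u" for u
  proof -
    have "q u > 0" using N(2)[OF that] by simp
    then have "\<bar>q' u\<bar> / (q u)\<^sup>2 \<le> 1/4" using N(3)[OF that] by (simp add: field_simps)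
    then have "q' u / (q u)\<^sup>2 \<le> 1 / 4"
      by (rule order_trans[rotated]) (auto intro: divide_right_mono)
    then show ?thesis by (simp add: g_def)
  qed
  have le: "w x \<le> w R + 3 / 2 * measure (mu q) {x..}" if "x \<le> R" for R
  proof -
    have g_cont: "continuous_on {x..R} g"
    proof -
      have "q u \<noteq> 0" if "x \<le> u" for u using N(2)[of u] x that by auto
      then show ?thesis
        unfolding g_def using N(1) x
        by (intro continuous_intros continuous_on_subset[OF q_cont] continuous_on_subset[OF q'_cont]) auto
    qed
    have F: "\<And>u. x \<le> u \<Longrightarrow> u \<le> R \<Longrightarrow>
        (w has_real_derivative 2 * exp (- gam q u) * g u) (at u within {x..R})"
      using N(1) x by (auto intro!: DERIV_subset[OF w])
    have "- (3 / 2) * measure (mu q) {x..} \<le> - (3 / 2) * measure (mu q) {x..R}"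
      by (auto intro!: finite_measure_mono)
    also have "\<dots> = (\<integral>u. indicator {x..R} u * (- (3 / 2)) \<partial>mu q)"
      by simp
    also have "\<dots> \<le> (\<integral>u. indicator {x..R} u * g u \<partial>mu q)"
    proof (rule integral_mono)
      show "integrable (mu q) (\<lambda>u. indicator {x..R} u * (- (3 / 2)) :: real)"
        by (intro integrable_mult_left integrable_real_indicator) (auto simp: less_top[symmetric])
      show "integrable (mu q) (\<lambda>u. indicator {x..R} u * g u)"
        using N(1) x by (intro integrable_mu_Icc[OF _ that F g_cont]) auto
      show "indicator {x..R} u * (- (3 / 2)) \<le> indicator {x..R} u * g u" for u
        using g_ge[of u] x by (auto split: split_indicator)
    qed
    also have "\<dots> = w R - w x"
      using N(1) x by (intro integral_mu_Icc[OF _ that F g_cont]) auto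
    finally show ?thesis by simp
  qed
  \<comment> \<open>The boundary term \<open>w R\<close> vanishes: exp (- gamma) does not increase
    beyond \<open>N\<close>, and 1 / q tends to 0.\<close>
  have "((\<lambda>R. exp (- gam q x) * inverse (q R)) \<longlongrightarrow> exp (- gam q x) * 0) at_top"
    by (intro tendsto_intros tendsto_inverse_0_at_top H2a)
  moreover have "eventually (\<lambda>R. \<bar>w R\<bar> \<le> exp (- gam q x) * inverse (q R)) at_top"
    using eventually_ge_at_top[of x]
  proof eventually_elim
    case (elim R)
    have "exp (- gam q R) \<le> exp (- gam q x)"
      using N x elim by (intro exp_neg_gam_mono[of N]) (auto intro: order_trans[OF _ N(2)])
    moreover have "q R > 0" using N(2)[of R] x elim by auto
    ultimately show ?case by (simp add: w_def field_simps)
  qed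
  ultimately have "(w \<longlongrightarrow> 0) at_top"
    by (auto intro: Lim_null_comparison)
  then have "((\<lambda>R. w R + 3 / 2 * measure (mu q) {x..}) \<longlongrightarrow> 0 + 3 / 2 * measure (mu q) {x..}) at_top"
    by (intro tendsto_intros)
  moreover have "eventually (\<lambda>R. w x \<le> w R + 3 / 2 * measure (mu q) {x..}) at_top"
    using eventually_ge_at_top[of x] by eventually_elim (rule le)
  ultimately have "w x \<le> 0 + 3 / 2 * measure (mu q) {x..}"
    by (rule tendsto_lowerbound) simp
  then have "exp (gam q x) * w x \<le> exp (gam q x) * (3 / 2 * measure (mu q) {x..})"
    by (intro mult_left_mono) simp_all
  moreover have "exp (gam q x) * w x = 1 / q x" by (simp add: w_def exp_minus)
  ultimately show ?thesis by simp
qed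

text \<open>The integral of 1 / q is the time that the noiseless flow x' = - q(x) takes from z down
  to y. It is bounded in z by (H1), so a \<open>y\<close> at which \<open>J\<close> is within e of
  its supremum leaves at most e.\<close>

lemma small_travel_time:
  assumes "0 < e"
    and N: "0 \<le> N" "\<And>x. N \<le> x \<Longrightarrow> 1 \<le> q x" "\<And>x. N \<le> x \<Longrightarrow> \<bar>q' x\<bar> \<le> (q x)\<^sup>2 / 4"
  obtains y where "N \<le> y" "\<And>z. y \<le> z \<Longrightarrow> integral {y..z} (\<lambda>x. 1 / q x) \<le> e"
proof -
  define J where "J z = integral {N..z} (\<lambda>x. 1 / q x)" for z
  let ?G = "\<lambda>y. indicator {0..} y * (exp (gam q y) * measure (mu q) {y..})"
  have cont: "continuous_on A (\<lambda>x. 1 / q x)" if "A \<subseteq> {N..}" for A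
  proof -
    have "q u \<noteq> 0" if "N \<le> u" for u using N(2)[OF that] by auto
    then show ?thesis
      using N(1) that by (intro continuous_intros continuous_on_subset[OF q_cont]) auto
  qed
  have J_le: "J z \<le> 3 / 2 * (\<integral>y. ?G y \<partial>lborel)" if "N \<le> z" for z
  proof -
    have "J z = (\<integral>x. indicator {N..z} x *\<^sub>R (1 / q x) \<partial>lborel)"
      using set_borel_integral_eq_integral(2)[OF borel_integrable_atLeastAtMost'[OF cont[of "{N..z}"]]]
      by (simp add: J_def set_lebesgue_integral_def)
    also have "\<dots> \<le> (\<integral>x. 3 / 2 * ?G x \<partial>lborel)"
    proof (rule integral_mono)
      show "integrable lborel (\<lambda>x. indicator {N..z} x *\<^sub>R (1 / q x))"
        using borel_integrable_atLeastAtMost'[OF cont[of "{N..z}"]] by (simp add: set_integrable_def)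
      show "integrable lborel (\<lambda>x. 3 / 2 * ?G x)"
        by (intro integrable_mult_right integrable_exp_gam_tail)
      show "indicator {N..z} x *\<^sub>R (1 / q x) \<le> 3 / 2 * ?G x" for x
        using inverse_drift_le_tail[OF N, of x] N(1) by (auto split: split_indicator)
    qed
    finally show ?thesis by simp
  qed
  have split: "J z = J y + integral {y..z} (\<lambda>x. 1 / q x)" if "N \<le> y" "y \<le> z" for y z
    unfolding J_def using that
    by (intro Henstock_Kurzweil_Integration.integral_combine[symmetric] integrable_continuous_real cont) auto
  have bdd: "bdd_above (J ` {N..})"
    by (rule bdd_aboveI2[where M = "3 / 2 * (\<integral>y. ?G y \<partial>lborel)"]) (use J_le in auto)
  then obtain y where y: "N \<le> y" "Sup (J ` {N..}) - e < J y"
    using less_cSUP_iff[of "{N..}" J "Sup (J ` {N..}) - e"] \<open>0 < e\<close> by auto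
  show ?thesis
  proof (rule that[of y])
    fix z assume "y \<le> z"
    then have "J z \<le> Sup (J ` {N..})" using y by (intro cSUP_upper bdd) auto
    then show "integral {y..z} (\<lambda>x. 1 / q x) \<le> e" using split[OF y(1) \<open>y \<le> z\<close>] y by simp
  qed (rule y)
qed

text \<open>The infimum of a set of reals is a lower bound only if the set is bounded below; this is
  why the threshold is moved to where q >= 1.\<close>

lemma quasi_monotone:
  obtains a N where "0 < a" "0 \<le> N" "\<And>x z. N \<le> x \<Longrightarrow> x \<le> z \<Longrightarrow> a * q x \<le> q z"
proof -
  obtain a N where a: "0 < a" "0 \<le> N" "\<And>x. N \<le> x \<Longrightarrow> a * q x \<le> Inf (q ` {x..})"
    using H3 by auto
  obtain N' where N': "0 \<le> N'" "\<And>x. N' \<le> x \<Longrightarrow> 1 \<le> q x"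
    using eventually_drift_bounds by metis
  show ?thesis
  proof (rule that[of a "max N N'"])
    fix x z assume xz: "max N N' \<le> x" "x \<le> z"
    have "bdd_below (q ` {x..})" using N' xz by (intro bdd_belowI2[of _ 1]) auto
    then have "Inf (q ` {x..}) \<le> q z" using xz by (intro cINF_lower) auto
    then show "a * q x \<le> q z" using a(3)[of x] xz by auto
  qed (use a N' in auto)
qed

end

section \<open>Eigenfunctions\<close>

lemma bessel_inequality:
  fixes e :: "nat \<Rightarrow> 'a \<Rightarrow> real" and g :: "'a \<Rightarrow> real"
  assumes gg: "integrable M (\<lambda>x. (g x)\<^sup>2)"
    and ge: "\<And>k. integrable M (\<lambda>x. g x * e k x)"
    and ee: "\<And>j k. integrable M (\<lambda>x. e j x * e k x)"
    and orth: "\<And>j k. (\<integral>x. e j x * e k x \<partial>M) = (if j = k then 1 else 0)"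
  shows "(\<Sum>k<n. (\<integral>x. g x * e k x \<partial>M)\<^sup>2) \<le> (\<integral>x. (g x)\<^sup>2 \<partial>M)"
proof -
  define c where "c k = (\<integral>x. g x * e k x \<partial>M)" for k
  have expand: "(g x - (\<Sum>k<n. c k * e k x))\<^sup>2 = (g x)\<^sup>2 - 2 * (\<Sum>k<n. c k * (g x * e k x))
      + (\<Sum>j<n. \<Sum>k<n. c j * c k * (e j x * e k x))" for x
    by (simp add: power2_diff power2_eq_square[of "sum _ _"] sum_product sum_distrib_left mult_ac)
  have "0 \<le> (\<integral>x. (g x - (\<Sum>k<n. c k * e k x))\<^sup>2 \<partial>M)"
    by simp
  also have "\<dots> = (\<integral>x. (g x)\<^sup>2 \<partial>M) - 2 * (\<Sum>k<n. c k * c k)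
      + (\<Sum>j<n. \<Sum>k<n. c j * c k * (if j = k then 1 else 0))"
    unfolding expand by (simp add: gg ge ee orth c_def[symmetric])
  also have "\<dots> = (\<integral>x. (g x)\<^sup>2 \<partial>M) - (\<Sum>k<n. (c k)\<^sup>2)"
    by (simp add: power2_eq_square if_distrib cong: if_cong)
  finally show ?thesis by (simp add: c_def)
qed

text \<open>One normalized eigenpair as a predicate, so that the constant of the sup bound can be
  fixed before the eigenpair is chosen. The equation for \<open>df\<close> is the eigenvalue
  equation solved for the second derivative.\<close>

locale bounded_eigenfunction = entrance_drift +
  fixes f df :: "real \<Rightarrow> real" and l :: real
  assumes l_pos: "0 < l"
    and f_deriv: "\<And>x. 0 \<le> x \<Longrightarrow> (f has_real_derivative df x) (at x within {0..})"
    and df_deriv: "\<And>x. 0 \<le> x \<Longrightarrow>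
      (df has_real_derivative 2 * q x * df x - 2 * l * f x) (at x within {0..})"
    and f_0: "f 0 = 0"
    and f_measurable [measurable]: "f \<in> borel_measurable borel"
    and f_bounded: "bounded (f ` {0..})"
    and f_normalized: "(\<integral>x. f x * f x \<partial>mu q) = 1"
begin

lemma f_bound: obtains K where "\<And>x. 0 \<le> x \<Longrightarrow> \<bar>f x\<bar> \<le> K"
proof -
  obtain K where "\<And>v. v \<in> f ` {0..} \<Longrightarrow> norm v \<le> K"
    using f_bounded unfolding bounded_iff by blast
  then show ?thesis using that[of K] by auto
qed

lemma f_cont: "continuous_on {0..} f"
  using f_deriv by (intro DERIV_continuous_on) auto

lemma df_cont: "continuous_on {0..} df"
  using df_deriv by (intro DERIV_continuous_on) auto

lemma integrable_f: "integrable (mu q) f"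
proof -
  obtain K where "\<And>x. 0 \<le> x \<Longrightarrow> \<bar>f x\<bar> \<le> K" using f_bound by blast
  then show ?thesis
    using AE_mu_nonneg by (intro integrable_const_bound[where B = K]) (auto elim!: eventually_mono)
qed

lemma integrable_f_square: "integrable (mu q) (\<lambda>x. f x * f x)"
  \<comment> \<open>A function that is not integrable has integral 0 by convention, whereas this
    integral is 1.\<close>
  using f_normalized not_integrable_integral_eq by fastforce

text \<open>The Sturm-Liouville form of the equation: multiplying by exp (- gamma) absorbs the
  first-order term.\<close>

lemma flux_deriv:
  "0 \<le> x \<Longrightarrow> ((\<lambda>x. exp (- gam q x) * df x) has_real_derivative
    2 * exp (- gam q x) * (- l * f x)) (at x within {0..})"
  by (auto intro!: derivative_eq_intros gam_deriv df_deriv simp: algebra_simps)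

lemma integral_tail_tendsto:
  fixes g :: "real \<Rightarrow> real"
  assumes "integrable (mu q) g"
  shows "((\<lambda>R. \<integral>x. indicator {z..R} x * g x \<partial>mu q) \<longlongrightarrow>
    (\<integral>x. indicator {z..} x * g x \<partial>mu q)) at_top"
proof -
  have "integrable (mu q) (\<lambda>x. indicator {z..} x * g x)"
    using integrable_mult_indicator[of "{z..}" "mu q" g] assms by simp
  from tendsto_integral_at_top[OF _ this]
  show ?thesis
    by (rule filterlim_cong[THEN iffD1, rotated 3])
      (auto intro!: always_eventually Bochner_Integration.integral_cong split: split_indicator)
qed

text \<open>Integrating the flux over [z, R] and letting R grow shows that it has a limit at
  infinity. A nonzero limit would make |f'| at least of order exp (gamma), against the boundedness
  of \<open>f\<close>.\<close>

lemma
  shows flux_tendsto_0: "((\<lambda>x. exp (- gam q x) * df x) \<longlongrightarrow> 0) at_top"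
    and flux_eq: "\<And>z. 0 \<le> z \<Longrightarrow>
      exp (- gam q z) * df z = l * (\<integral>x. indicator {z..} x * f x \<partial>mu q)"
proof -
  let ?p = "\<lambda>x. exp (- gam q x) * df x"
  \<comment> \<open>\<open>c z\<close> is the limit of the flux at infinity, computed from z; by
    uniqueness of limits it is the same for all z >= 0.\<close>
  define c where "c z = ?p z - l * (\<integral>x. indicator {z..} x * f x \<partial>mu q)" for z
  have lim: "(?p \<longlongrightarrow> c z) at_top" if "0 \<le> z" for z
  proof -
    have "eventually (\<lambda>R. ?p z - l * (\<integral>x. indicator {z..R} x * f x \<partial>mu q) = ?p R) at_top"
      using eventually_ge_at_top[of z]
    proof eventually_elim
      case (elim R)
      have "(\<integral>x. indicator {z..R} x * (- l * f x) \<partial>mu q) = ?p R - ?p z"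
      proof (rule integral_mu_Icc)
        show "(?p has_real_derivative 2 * exp (- gam q x) * (- l * f x)) (at x within {z..R})"
          if "z \<le> x" "x \<le> R" for x
          by (rule DERIV_subset[OF flux_deriv]) (use \<open>0 \<le> z\<close> that in auto)
        show "continuous_on {z..R} (\<lambda>x. - l * f x)"
          using \<open>0 \<le> z\<close> by (intro continuous_intros continuous_on_subset[OF f_cont]) auto
      qed (use that elim in auto)
      moreover have "(\<integral>x. indicator {z..R} x * (- l * f x) \<partial>mu q)
          = - l * (\<integral>x. indicator {z..R} x * f x \<partial>mu q)"
        by (subst integral_mult_right_zero[symmetric]) (simp add: mult_ac)
      ultimately show ?case by simp
    qed
    moreover have "((\<lambda>R. ?p z - l * (\<integral>x. indicator {z..R} x * f x \<partial>mu q)) \<longlongrightarrow> c z) at_top"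
      unfolding c_def by (intro tendsto_intros integral_tail_tendsto integrable_f)
    ultimately show ?thesis by (rule Lim_transform_eventually[rotated])
  qed
  have c0: "c 0 = 0"
  proof (rule ccontr)
    assume "c 0 \<noteq> 0"
    obtain N where N: "0 \<le> N" "\<And>x. N \<le> x \<Longrightarrow> 1 \<le> q x"
      using eventually_drift_bounds by metis
    have "eventually (\<lambda>x. \<bar>c 0\<bar> / 2 < \<bar>?p x\<bar>) at_top"
      using order_tendstoD(1)[OF tendsto_rabs[OF lim[of 0]], of "\<bar>c 0\<bar> / 2"] \<open>c 0 \<noteq> 0\<close> by simp
    then obtain N' where N': "\<And>x. N' \<le> x \<Longrightarrow> \<bar>c 0\<bar> / 2 < \<bar>?p x\<bar>"
      by (auto simp: eventually_at_top_linorder)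
    define b where "b = max N N'"
    obtain K where K: "\<And>x. 0 \<le> x \<Longrightarrow> \<bar>f x\<bar> \<le> K" using f_bound by blast
    \<comment> \<open>Dividing the flux by exp (- gamma) only helps, since gamma does not decrease
      beyond \<open>N\<close>.\<close>
    have steep: "\<bar>c 0\<bar> / 2 * exp (gam q N) \<le> \<bar>df x\<bar>" if "b \<le> x" for x
    proof -
      have "\<bar>c 0\<bar> / 2 * exp (gam q N) \<le> \<bar>?p x\<bar> * exp (gam q x)"
      proof (intro mult_mono)
        have "exp (- gam q x) \<le> exp (- gam q N)"
          using N that by (intro exp_neg_gam_mono[of N]) (auto intro: order_trans[OF _ N(2)] simp: b_def)
        then show "exp (gam q N) \<le> exp (gam q x)" by simp
        show "\<bar>c 0\<bar> / 2 \<le> \<bar>?p x\<bar>" using N'[of x] that by (simp add: b_def)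
      qed auto
      also have "\<dots> = \<bar>df x\<bar>" by (simp add: abs_mult exp_minus)
      finally show ?thesis .
    qed
    show False
    proof (rule steep_imp_unbounded[where F = f and F' = df and a = b])
      show "(f has_real_derivative df x) (at x within {b..})" if "b \<le> x" for x
        using that N(1) by (auto intro!: DERIV_subset[OF f_deriv] simp: b_def)
      show "0 < \<bar>c 0\<bar> / 2 * exp (gam q N)" using \<open>c 0 \<noteq> 0\<close> by simp
      show "\<bar>f x\<bar> \<le> K" if "b \<le> x" for x using that N(1) K by (auto simp: b_def)
    qed (rule steep)
  qed
  then show "(?p \<longlongrightarrow> 0) at_top" using lim[of 0] by simp
  fix z :: real assume "0 \<le> z"
  have "c z = 0" using tendsto_unique[OF _ lim[OF \<open>0 \<le> z\<close>] lim[of 0]] c0 by simp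
  then show "?p z = l * (\<integral>x. indicator {z..} x * f x \<partial>mu q)" by (simp add: c_def)
qed

text \<open>Test the equation with \<open>f\<close> itself: \<open>E\<close>, the flux times
  \<open>f\<close>, has derivative f'^2 / 2 - l f^2 relative to the density of \<open>mu q\<close>.
  It vanishes at 0 since f(0) = 0, and at infinity since the flux tends to 0 and \<open>f\<close> is
  bounded. The normalization turns l times the integral of f^2 into l.\<close>

lemma energy_lower_bound:
  "ennreal l \<le> (\<integral>\<^sup>+ x. ennreal (indicator {0..} x * (exp (- gam q x) * (df x)\<^sup>2)) \<partial>lborel)"
    (is "_ \<le> ?W")
proof -
  define E where "E x = exp (- gam q x) * df x * f x" for x
  have E: "(E has_real_derivative 2 * exp (- gam q x) * ((df x)\<^sup>2 / 2 - l * (f x * f x))) (at x within {0..})"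
    if "0 \<le> x" for x
    unfolding E_def using DERIV_mult[OF flux_deriv[OF that] f_deriv[OF that]]
    by (rule DERIV_cong) (simp add: algebra_simps power2_eq_square)
  \<comment> \<open>The identity cut off at R. Its right-hand side is below \<open>?W\<close> for
    each R, so no integrability of f'^2 on the half line has to be known beforehand.\<close>
  have part: "ennreal (E R + l * (\<integral>x. indicator {0..R} x * (f x * f x) \<partial>mu q)) \<le> ?W" if "0 \<le> R" for R
  proof -
    have c: "continuous_on {0..R} (\<lambda>x. (df x)\<^sup>2 / 2 - l * (f x * f x))"
      by (intro continuous_intros continuous_on_subset[OF f_cont] continuous_on_subset[OF df_cont]) auto
    have E': "\<And>x. 0 \<le> x \<Longrightarrow> x \<le> R \<Longrightarrow> (E has_real_derivative
        2 * exp (- gam q x) * ((df x)\<^sup>2 / 2 - l * (f x * f x))) (at x within {0..R})"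
      by (auto intro: DERIV_subset[OF E])
    have i1: "integrable (mu q) (\<lambda>x. indicator {0..R} x * ((df x)\<^sup>2 / 2 - l * (f x * f x)))"
      by (rule integrable_mu_Icc[OF _ that E' c]) auto
    have i2: "integrable (mu q) (\<lambda>x. indicator {0..R} x * (f x * f x))"
      using integrable_mult_indicator[OF _ integrable_f_square, of "{0..R}"] by simp
    have eq: "indicator {0..R} x * ((df x)\<^sup>2 / 2) = indicator {0..R} x * ((df x)\<^sup>2 / 2 - l * (f x * f x))
        + l * (indicator {0..R} x * (f x * f x))" for x :: real
      by (simp add: algebra_simps)
    have i3: "integrable (mu q) (\<lambda>x. indicator {0..R} x * ((df x)\<^sup>2 / 2))"
      unfolding eq by (intro Bochner_Integration.integrable_add i1 integrable_mult_right i2)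
    have "E 0 = 0" by (simp add: E_def f_0)
    then have "E R + l * (\<integral>x. indicator {0..R} x * (f x * f x) \<partial>mu q)
        = (\<integral>x. indicator {0..R} x * ((df x)\<^sup>2 / 2) \<partial>mu q)"
      unfolding eq using integral_mu_Icc[OF _ that E' c] i1 i2 by simp
    also have "ennreal \<dots> = (\<integral>\<^sup>+ x. ennreal (indicator {0..R} x * ((df x)\<^sup>2 / 2)) \<partial>mu q)"
      by (intro nn_integral_eq_integral[symmetric] i3) (auto split: split_indicator)
    also have "\<dots> = (\<integral>\<^sup>+ x. ennreal (indicator {0..} x * (2 * exp (- gam q x))) *
        ennreal (indicator {0..R} x * ((df x)\<^sup>2 / 2)) \<partial>lborel)"
      using borel_measurable_integrable[OF i3] by (intro nn_integral_mu) (simp cong: measurable_cong_sets)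
    also have "\<dots> \<le> ?W"
      by (intro nn_integral_mono) (auto split: split_indicator simp: ennreal_mult[symmetric])
    finally show ?thesis .
  qed
  obtain K where K: "\<And>x. 0 \<le> x \<Longrightarrow> \<bar>f x\<bar> \<le> K" using f_bound by blast
  have "(E \<longlongrightarrow> 0) at_top"
  proof (rule Lim_null_comparison)
    show "eventually (\<lambda>x. norm (E x) \<le> K * \<bar>exp (- gam q x) * df x\<bar>) at_top"
      using eventually_ge_at_top[of 0]
    proof eventually_elim
      case (elim x)
      have "norm (E x) = \<bar>f x\<bar> * \<bar>exp (- gam q x) * df x\<bar>" by (simp add: E_def abs_mult)
      also have "\<dots> \<le> K * \<bar>exp (- gam q x) * df x\<bar>" using K[OF elim] by (intro mult_right_mono) auto
      finally show ?case .
    qed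
    show "((\<lambda>x. K * \<bar>exp (- gam q x) * df x\<bar>) \<longlongrightarrow> 0) at_top"
      using tendsto_mult_left[OF tendsto_rabs[OF flux_tendsto_0], of K] by simp
  qed
  moreover have "(\<integral>x. indicator {0..} x * (f x * f x) \<partial>mu q) = (\<integral>x. f x * f x \<partial>mu q)"
    using AE_mu_nonneg by (intro integral_cong_AE) (auto elim!: eventually_mono)
  ultimately have "((\<lambda>R. E R + l * (\<integral>x. indicator {0..R} x * (f x * f x) \<partial>mu q)) \<longlongrightarrow> 0 + l * 1) at_top"
    using integral_tail_tendsto[OF integrable_f_square, of 0]
    by (intro tendsto_intros) (simp_all add: f_normalized)
  then have "((\<lambda>R. ennreal (E R + l * (\<integral>x. indicator {0..R} x * (f x * f x) \<partial>mu q))) \<longlongrightarrow> ennreal l) at_top"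
    by (intro tendsto_ennrealI) simp
  then show ?thesis
    by (rule tendsto_upperbound) (use eventually_mono[OF eventually_ge_at_top[of 0] part] in auto)
qed

text \<open>By 2 |f| <= 1 + f^2 and the normalization, the bound is the same for all eigenpairs and
  all z; only the explicit factor l remains in the flux formula.\<close>

lemma abs_tail_integral_le: "\<bar>\<integral>x. indicator {z..} x * f x \<partial>mu q\<bar> \<le> measure (mu q) UNIV + 1"
proof -
  have "\<bar>\<integral>x. indicator {z..} x * f x \<partial>mu q\<bar> \<le> (\<integral>x. 1 + f x * f x \<partial>mu q)"
  proof (rule order_trans[OF integral_abs_bound integral_mono])
    show "integrable (mu q) (\<lambda>x. \<bar>indicator {z..} x * f x\<bar>)"
      using integrable_mult_indicator[of "{z..}" "mu q" f] integrable_f by (intro integrable_abs) simp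
    show "integrable (mu q) (\<lambda>x. 1 + f x * f x)"
      by (intro Bochner_Integration.integrable_add integrable_f_square) auto
    fix x
    have "0 \<le> (\<bar>f x\<bar> - 1)\<^sup>2" by simp
    then have "2 * \<bar>f x\<bar> \<le> 1 + f x * f x" by (simp add: power2_eq_square algebra_simps)
    then show "\<bar>indicator {z..} x * f x\<bar> \<le> 1 + f x * f x"
      by (auto split: split_indicator)
  qed
  also have "\<dots> = measure (mu q) UNIV + 1"
    using integrable_f_square f_normalized by simp
  finally show ?thesis .
qed

end

section \<open>Estimates uniform over the spectrum\<close>

context entrance_drift
begin

text \<open>Bessel's inequality is used pointwise in x, before integration: the flux formula
  identifies exp (- gamma) psi_k'^2 / lam_k^2 with exp (gamma) times the squared k-th coefficient of
  the indicator of [x, oo). Integration in x produces energies, each at least lam_k.\<close>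

lemma sum_inverse_eigenvalues_bound:
  fixes psi dpsi :: "nat \<Rightarrow> real \<Rightarrow> real" and lam :: "nat \<Rightarrow> real"
  assumes eig: "\<And>k. bounded_eigenfunction q q' (psi k) (dpsi k) (lam k)"
    and orth: "\<And>j k. integrable (mu q) (\<lambda>x. psi j x * psi k x)
                      \<and> (\<integral>x. psi j x * psi k x \<partial>mu q) = (if j = k then 1 else 0)"
  shows "(\<Sum>k<n. 1 / lam k)
    \<le> (\<integral>y. indicator {0..} y * (exp (gam q y) * measure (mu q) {y..}) \<partial>lborel)"
proof -
  let ?T = "\<lambda>y. indicator {0..} y * (exp (gam q y) * measure (mu q) {y..})"
  let ?w = "\<lambda>k x. indicator {0..} x * (exp (- gam q x) * (dpsi k x)\<^sup>2)"
  note lam_pos = bounded_eigenfunction.l_pos[OF eig]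
  have meas [measurable]: "?w k \<in> borel_measurable borel" for k
  proof -
    have "(\<lambda>x. indicator {0..} x *\<^sub>R (exp (- gam q x) * (dpsi k x)\<^sup>2)) \<in> borel_measurable borel"
      by (intro borel_measurable_continuous_on_indicator continuous_intros gam_cont
        bounded_eigenfunction.df_cont[OF eig]) auto
    then show ?thesis by simp
  qed
  have le: "(\<Sum>k<n. ?w k x / (lam k)\<^sup>2) \<le> ?T x" for x
  proof (cases "0 \<le> x")
    case True
    define c where "c k = (\<integral>u. indicator {x..} u * psi k u \<partial>mu q)" for k
    have "(\<Sum>k<n. (c k)\<^sup>2) \<le> (\<integral>u. (indicator {x..} u)\<^sup>2 \<partial>mu q)"
      unfolding c_def
    proof (rule bessel_inequality)
      show "integrable (mu q) (\<lambda>u. (indicator {x..} u)\<^sup>2 :: real)"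
        by (simp add: power2_eq_square indicator_inter_arith[symmetric] less_top[symmetric])
      show "integrable (mu q) (\<lambda>u. indicator {x..} u * psi k u)" for k
        using integrable_mult_indicator[of "{x..}" "mu q" "psi k"]
          bounded_eigenfunction.integrable_f[OF eig] by simp
    qed (use orth in auto)
    also have "\<dots> = measure (mu q) {x..}"
      by (simp add: power2_eq_square indicator_inter_arith[symmetric])
    finally have bessel: "(\<Sum>k<n. (c k)\<^sup>2) \<le> measure (mu q) {x..}" .
    have "?w k x / (lam k)\<^sup>2 = exp (gam q x) * (c k)\<^sup>2" for k
    proof -
      have "dpsi k x = exp (gam q x) * (lam k * c k)"
        using bounded_eigenfunction.flux_eq[OF eig True, of k]
        by (simp add: c_def exp_minus field_simps)
      then show ?thesis
        using True lam_pos[of k] by (simp add: power_mult_distrib exp_minus power2_eq_square field_simps)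
    qed
    then have "(\<Sum>k<n. ?w k x / (lam k)\<^sup>2) = exp (gam q x) * (\<Sum>k<n. (c k)\<^sup>2)"
      by (simp add: sum_distrib_left)
    also have "\<dots> \<le> ?T x" using bessel True by simp
    finally show ?thesis .
  qed simp
  have "ennreal (\<Sum>k<n. 1 / lam k) = (\<Sum>k<n. ennreal (1 / (lam k)\<^sup>2) * ennreal (lam k))"
  proof -
    have "1 / lam k = 1 / (lam k)\<^sup>2 * lam k" for k using lam_pos[of k] by (simp add: power2_eq_square)
    then show ?thesis
      using lam_pos by (simp add: sum_ennreal[symmetric] ennreal_mult[symmetric] less_imp_le del: sum_ennreal)
  qed
  also have "\<dots> \<le> (\<Sum>k<n. ennreal (1 / (lam k)\<^sup>2) * (\<integral>\<^sup>+ x. ennreal (?w k x) \<partial>lborel))"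
    by (intro sum_mono mult_left_mono bounded_eigenfunction.energy_lower_bound[OF eig]) auto
  also have "\<dots> = (\<integral>\<^sup>+ x. (\<Sum>k<n. ennreal (1 / (lam k)\<^sup>2) * ennreal (?w k x)) \<partial>lborel)"
    by (simp add: nn_integral_sum nn_integral_cmult)
  also have "\<dots> \<le> (\<integral>\<^sup>+ x. ennreal (?T x) \<partial>lborel)"
  proof (intro nn_integral_mono)
    fix x
    have "(\<Sum>k<n. ennreal (1 / (lam k)\<^sup>2) * ennreal (?w k x)) = ennreal (\<Sum>k<n. ?w k x / (lam k)\<^sup>2)"
      by (simp add: ennreal_mult[symmetric] sum_ennreal)
    also have "\<dots> \<le> ennreal (?T x)" using le by (rule ennreal_leI)
    finally show "(\<Sum>k<n. ennreal (1 / (lam k)\<^sup>2) * ennreal (?w k x)) \<le> ennreal (?T x)" .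
  qed
  also have "\<dots> = ennreal (\<integral>y. ?T y \<partial>lborel)"
    by (intro nn_integral_eq_integral integrable_exp_gam_tail) auto
  finally show ?thesis
    by (subst (asm) ennreal_le_iff) (auto intro!: integral_nonneg_AE)
qed

text \<open>\<open>C\<close> depends on e and the drift only. On [0, y] the initial energy is at
  most K (l^2 + l) by the flux formula and f(0) = 0; past y it is multiplied by at most exp (e
  l).\<close>

lemma subexponential_eigenfunction_bound:
  assumes "0 < e"
  obtains C where "\<And>f df l x. bounded_eigenfunction q q' f df l \<Longrightarrow> 0 \<le> x \<Longrightarrow> \<bar>f x\<bar> \<le> C * exp (e * l)"
proof -
  obtain a N1 where a: "0 < a" "0 \<le> N1" "\<And>x z. N1 \<le> x \<Longrightarrow> x \<le> z \<Longrightarrow> a * q x \<le> q z"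
    using quasi_monotone by metis
  obtain N2 where N2: "0 \<le> N2" "\<And>x. N2 \<le> x \<Longrightarrow> 1 \<le> q x" "\<And>x. N2 \<le> x \<Longrightarrow> \<bar>q' x\<bar> \<le> (q x)\<^sup>2 / 4"
    using eventually_drift_bounds by metis
  define N where "N = max N1 N2"
  have N: "0 \<le> N" "\<And>x. N \<le> x \<Longrightarrow> 1 \<le> q x" "\<And>x. N \<le> x \<Longrightarrow> \<bar>q' x\<bar> \<le> (q x)\<^sup>2 / 4"
    using N2 by (auto simp: N_def)
  \<comment> \<open>Makes the growth exponent 32 l / a^2 times the travel time at most e l.\<close>
  have "0 < e * a\<^sup>2 / 32" using \<open>0 < e\<close> a by simp
  then obtain y where y: "N \<le> y" "\<And>z. y \<le> z \<Longrightarrow> integral {y..z} (\<lambda>x. 1 / q x) \<le> e * a\<^sup>2 / 32"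
    using small_travel_time[OF _ N] by metis
  have "0 \<le> y" using y N by simp
  have "bounded ((\<lambda>x. exp (gam q x)) ` {0..y})"
    by (intro compact_imp_bounded compact_continuous_image continuous_intros
        continuous_on_subset[OF gam_cont]) auto
  then obtain G where "\<And>v. v \<in> (\<lambda>x. exp (gam q x)) ` {0..y} \<Longrightarrow> norm v \<le> G"
    unfolding bounded_iff by blast
  then have G: "exp (gam q x) \<le> G" if "0 \<le> x" "x \<le> y" for x using that by force
  define m where "m = measure (mu q) UNIV + 1"
  have "0 \<le> m" "0 \<le> G" using G[of 0] \<open>0 \<le> y\<close> by (auto simp: m_def intro: order_trans[OF exp_ge_zero])
  define K where "K = (m * G)\<^sup>2 * (y\<^sup>2 + 1)"
  \<comment> \<open>Here l <= exp (e l) / e and l^2 <= 2 exp (e l) / e^2 absorb the polynomial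
    factor. This gives f^2 <= C^2 exp (2 e l), and the square root restores the rate e.\<close>
  define C where "C = sqrt (K * (2 / e\<^sup>2 + 1 / e))"
  show ?thesis
  proof (rule that[of C])
    fix f df and l x :: real
    assume "bounded_eigenfunction q q' f df l" and "0 \<le> x"
    then interpret bounded_eigenfunction q q' f df l by simp
    have df_le: "\<bar>df z\<bar> \<le> l * (m * G)" if "0 \<le> z" "z \<le> y" for z
    proof -
      have "df z = exp (gam q z) * (l * (\<integral>x. indicator {z..} x * f x \<partial>mu q))"
        using flux_eq[OF that(1)] by (simp add: exp_minus field_simps)
      then have "\<bar>df z\<bar> = l * (exp (gam q z) * \<bar>\<integral>x. indicator {z..} x * f x \<partial>mu q\<bar>)"
        using l_pos by (simp add: abs_mult)
      also have "\<dots> \<le> l * (G * m)"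
        using l_pos \<open>0 \<le> G\<close> G[OF that] abs_tail_integral_le unfolding m_def
        by (intro mult_left_mono mult_mono) auto
      finally show ?thesis by (simp add: mult_ac)
    qed
    have f_le: "\<bar>f z\<bar> \<le> l * (m * G) * y" if "0 \<le> z" "z \<le> y" for z
    proof (cases "z = 0")
      case True
      then show ?thesis using f_0 l_pos \<open>0 \<le> m\<close> \<open>0 \<le> G\<close> \<open>0 \<le> y\<close> by simp
    next
      case False
      have "\<And>u. 0 \<le> u \<Longrightarrow> u \<le> z \<Longrightarrow> (f has_real_derivative df u) (at u within {0..z})"
        by (auto intro: DERIV_subset[OF f_deriv])
      moreover have "0 < z" using that False by simp
      ultimately obtain u where u: "0 < u" "u < z" "f z - f 0 = df u * (z - 0)"
        using mvt_Icc[of 0 z f df] by blast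
      then have "\<bar>f z\<bar> = \<bar>df u\<bar> * z" using that by (simp add: f_0 abs_mult)
      also have "\<dots> \<le> l * (m * G) * y"
        using df_le[of u] u that l_pos \<open>0 \<le> m\<close> \<open>0 \<le> G\<close> by (intro mult_mono) auto
      finally show ?thesis .
    qed
    have "0 \<le> K" by (simp add: K_def)
    have init: "(f z)\<^sup>2 + (df z)\<^sup>2 / (2 * l) \<le> K * (l\<^sup>2 + l)" if "0 \<le> z" "z \<le> y" for z
    proof -
      have "(f z)\<^sup>2 \<le> (l * (m * G) * y)\<^sup>2"
        using power_mono[OF f_le[OF that], of 2] by simp
      moreover have "(df z)\<^sup>2 / (2 * l) \<le> (l * (m * G))\<^sup>2 / (2 * l)"
        using power_mono[OF df_le[OF that], of 2] l_pos by (intro divide_right_mono) auto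
      moreover have "(l * (m * G))\<^sup>2 / (2 * l) = l * (m * G)\<^sup>2 / 2"
        using l_pos by (simp add: power2_eq_square)
      moreover have "0 \<le> l * (m * G)\<^sup>2" using l_pos by (intro mult_nonneg_nonneg; simp)
      moreover have "(l * (m * G) * y)\<^sup>2 = l\<^sup>2 * ((m * G)\<^sup>2 * y\<^sup>2)"
        by (simp add: power_mult_distrib)
      moreover have "K * (l\<^sup>2 + l) = l\<^sup>2 * ((m * G)\<^sup>2 * y\<^sup>2) + l * (m * G)\<^sup>2
          + l\<^sup>2 * (m * G)\<^sup>2 + l * ((m * G)\<^sup>2 * y\<^sup>2)"
        by (simp add: K_def algebra_simps)
      moreover have "0 \<le> l\<^sup>2 * (m * G)\<^sup>2" "0 \<le> l * ((m * G)\<^sup>2 * y\<^sup>2)"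
        using l_pos by (intro mult_nonneg_nonneg; simp)+
      ultimately show ?thesis by linarith
    qed
    have grow: "(f x)\<^sup>2 \<le> K * (l\<^sup>2 + l) * exp (e * l)"
    proof (cases "x \<le> y")
      case True
      have "(f x)\<^sup>2 \<le> (f x)\<^sup>2 + (df x)\<^sup>2 / (2 * l)" using l_pos by simp
      also have "\<dots> \<le> K * (l\<^sup>2 + l)" using init \<open>0 \<le> x\<close> True by auto
      also have "\<dots> \<le> K * (l\<^sup>2 + l) * exp (e * l)"
        using mult_left_mono[of 1 "exp (e * l)" "K * (l\<^sup>2 + l)"] \<open>0 \<le> K\<close> l_pos \<open>0 < e\<close> by simp
      finally show ?thesis .
    next
      case False
      define J where "J z = integral {y..z} (\<lambda>x. 1 / q x)" for z
      have qy: "q u > 0" if "y \<le> u" for u using N(2)[of u] y(1) that by auto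
      have "continuous_on {y..} (\<lambda>x. 1 / q x)"
        using \<open>0 \<le> y\<close> qy by (intro continuous_intros continuous_on_subset[OF q_cont]) force+
      then have J: "(J has_real_derivative 1 / q u) (at u within {y..})" if "y \<le> u" for u
        unfolding J_def using that by (intro has_real_derivative_integral_atLeast)
      obtain B where B: "\<And>x. 0 \<le> x \<Longrightarrow> \<bar>f x\<bar> \<le> B" using f_bound by blast
      have "(f x)\<^sup>2 \<le> ((f y)\<^sup>2 + (df y)\<^sup>2 / (2 * l)) * exp (32 * l / a\<^sup>2 * (J x - J y))"
      proof (rule eigenfunction_growth[where q = q and q' = q' and M = B])
        show "\<bar>q' u\<bar> \<le> (q u)\<^sup>2 / 4" if "y \<le> u" for u using N(3)[of u] y(1) that by auto
        show "a * q u \<le> q z" if "y \<le> u" "u \<le> z" for u z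
          using that y(1) by (intro a) (auto simp: N_def)
        show "\<bar>f u\<bar> \<le> B" if "y \<le> u" for u using that B \<open>0 \<le> y\<close> by auto
      qed (use \<open>0 \<le> y\<close> l_pos a False in \<open>auto intro: DERIV_subset[OF q_deriv] DERIV_subset[OF f_deriv]
          DERIV_subset[OF df_deriv] J qy H2a\<close>)
      also have "\<dots> \<le> K * (l\<^sup>2 + l) * exp (e * l)"
      proof (rule mult_mono)
        have "32 * l / a\<^sup>2 * (J x - J y) \<le> 32 * l / a\<^sup>2 * (e * a\<^sup>2 / 32)"
          using y(2)[of x] False l_pos by (intro mult_left_mono) (auto simp: J_def)
        then show "exp (32 * l / a\<^sup>2 * (J x - J y)) \<le> exp (e * l)"
          using a by (simp add: mult_ac)
      qed (use init \<open>0 \<le> y\<close> \<open>0 \<le> K\<close> l_pos in auto)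
      finally show ?thesis .
    qed
    have "e * l \<le> exp (e * l)" using exp_ge_add_one_self[of "e * l"] by linarith
    then have "l \<le> exp (e * l) / e" using \<open>0 < e\<close> by (simp add: field_simps)
    moreover have "l\<^sup>2 \<le> 2 * exp (e * l) / e\<^sup>2"
    proof -
      have "0 \<le> e * l" using l_pos \<open>0 < e\<close> by simp
      then have "(e * l)\<^sup>2 / 2 \<le> exp (e * l)"
        using exp_lower_Taylor_quadratic[of "e * l"] by linarith
      then show ?thesis using \<open>0 < e\<close> by (simp add: power_mult_distrib field_simps)
    qed
    ultimately have "l\<^sup>2 + l \<le> (2 / e\<^sup>2 + 1 / e) * exp (e * l)"
      by (simp add: algebra_simps)
    then have "K * (l\<^sup>2 + l) * exp (e * l) \<le> K * ((2 / e\<^sup>2 + 1 / e) * exp (e * l)) * exp (e * l)"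
      using \<open>0 \<le> K\<close> by (intro mult_right_mono mult_left_mono) auto
    also have "\<dots> = (C * exp (e * l))\<^sup>2"
      using \<open>0 \<le> K\<close> \<open>0 < e\<close> by (simp add: C_def power_mult_distrib power2_eq_square[of "exp _"] mult_ac)
    finally have "(f x)\<^sup>2 \<le> (C * exp (e * l))\<^sup>2" using grow by linarith
    then have "\<bar>f x\<bar> \<le> \<bar>C * exp (e * l)\<bar>" by (simp add: abs_le_square_iff)
    moreover have "0 \<le> C" using \<open>0 \<le> K\<close> \<open>0 < e\<close> by (simp add: C_def)
    ultimately show "\<bar>f x\<bar> \<le> C * exp (e * l)" by simp
  qed
qed

lemma eigenfunction_sup_bounds:
  fixes psi dpsi :: "nat \<Rightarrow> real \<Rightarrow> real" and lam :: "nat \<Rightarrow> real"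
  assumes eig: "\<And>k. bounded_eigenfunction q q' (psi k) (dpsi k) (lam k)"
    and orth: "\<And>j k. integrable (mu q) (\<lambda>x. psi j x * psi k x)
                      \<and> (\<integral>x. psi j x * psi k x \<partial>mu q) = (if j = k then 1 else 0)"
    and "0 < s"
  obtains b where "\<And>k x. 0 \<le> x \<Longrightarrow> \<bar>psi k x\<bar> \<le> b k" "\<And>k. 0 \<le> b k"
    "summable (\<lambda>k. exp (- lam k * s) * (b k)\<^sup>2)"
proof -
  note lam_pos = bounded_eigenfunction.l_pos[OF eig]
  \<comment> \<open>With rate s / 4 the squared bound grows like exp (s lam / 2). What remains of
    the time factor is exp (- s lam / 2) <= 2 / (s lam), summable by the trace bound.\<close>
  have "0 < s / 4" using \<open>0 < s\<close> by simp
  then obtain C where C: "\<And>f df l x. bounded_eigenfunction q q' f df l \<Longrightarrow> 0 \<le> x \<Longrightarrow>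
      \<bar>f x\<bar> \<le> C * exp (s / 4 * l)"
    using subexponential_eigenfunction_bound by metis
  show ?thesis
  proof (rule that[of "\<lambda>k. C * exp (s / 4 * lam k)"])
    show bound: "\<bar>psi k x\<bar> \<le> C * exp (s / 4 * lam k)" if "0 \<le> x" for k x
      using C[OF eig that] .
    show "0 \<le> C * exp (s / 4 * lam k)" for k
      using bound[of 0 k] by linarith
    have "summable (\<lambda>k. 1 / lam k)"
      using lam_pos sum_inverse_eigenvalues_bound[OF eig orth]
      by (intro summableI_nonneg_bounded) (auto simp: less_imp_le)
    then have "summable (\<lambda>k. 2 * C\<^sup>2 / s * (1 / lam k))" by (rule summable_mult)
    then show "summable (\<lambda>k. exp (- lam k * s) * (C * exp (s / 4 * lam k))\<^sup>2)"
    proof (rule summable_comparison_test'[where N = 0])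
      fix k
      have "s * lam k / 2 \<le> exp (s * lam k / 2)"
        using exp_ge_add_one_self[of "s * lam k / 2"] by linarith
      then have "exp (- (s * lam k / 2)) \<le> 2 / (s * lam k)"
        using \<open>0 < s\<close> lam_pos[of k] by (simp add: exp_minus field_simps)
      then have "C\<^sup>2 * exp (- (s * lam k / 2)) \<le> C\<^sup>2 * (2 / (s * lam k))"
        by (intro mult_left_mono) auto
      moreover have "exp (- lam k * s) * (C * exp (s / 4 * lam k))\<^sup>2 = C\<^sup>2 * exp (- (s * lam k / 2))"
        by (simp add: power_mult_distrib exp_add[symmetric] power2_eq_square[of "exp _"] mult.left_commute[of "exp _"])
      ultimately show "norm (exp (- lam k * s) * (C * exp (s / 4 * lam k))\<^sup>2) \<le> 2 * C\<^sup>2 / s * (1 / lam k)"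
        by (simp add: mult_ac)
    qed
  qed
qed

end

section \<open>The kernel series\<close>

text \<open>Tannery's theorem applied to the x-free majorant \<open>\<delta>\<close>. The filter is
  left open because two limits are taken: the starting point tending to infinity, and time tending
  to t.\<close>

lemma uniform_series_tendsto:
  fixes h :: "nat \<Rightarrow> 'i \<Rightarrow> real" and psi :: "nat \<Rightarrow> 'x \<Rightarrow> real"
  assumes "F \<noteq> bot"
    and lim: "\<And>k. (h k \<longlongrightarrow> g k) F"
    and dom: "eventually (\<lambda>i. \<forall>k. \<bar>h k i\<bar> \<le> d k) F"
    and b: "\<And>k x. x \<in> S \<Longrightarrow> \<bar>psi k x\<bar> \<le> b k" "\<And>k. 0 \<le> b k"
    and sm: "summable (\<lambda>k. d k * b k)"
  obtains \<delta> where "(\<delta> \<longlongrightarrow> 0) F"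
    "eventually (\<lambda>i. \<forall>x\<in>S. \<bar>(\<Sum>k. h k i * psi k x) - (\<Sum>k. g k * psi k x)\<bar> \<le> \<delta> i) F"
proof -
  have g: "\<bar>g k\<bar> \<le> d k" for k
    by (rule tendsto_upperbound[OF tendsto_rabs[OF lim[of k]] _ \<open>F \<noteq> bot\<close>])
      (use dom in \<open>auto elim: eventually_mono\<close>)
  define \<delta> where "\<delta> i = (\<Sum>k. \<bar>h k i - g k\<bar> * b k)" for i
  have diff: "\<bar>h k i - g k\<bar> * b k \<le> 2 * (d k * b k)" if "\<bar>h k i\<bar> \<le> d k" for k i
  proof -
    have "\<bar>h k i - g k\<bar> \<le> 2 * d k" using that g[of k] by linarith
    then have "\<bar>h k i - g k\<bar> * b k \<le> 2 * d k * b k" using b(2) by (intro mult_right_mono)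
    then show ?thesis by simp
  qed
  have "((\<lambda>i. \<Sum>k. \<bar>h k i - g k\<bar> * b k) \<longlongrightarrow> (\<Sum>k. 0)) F"
  proof (rule tannerys_theorem[THEN conjunct2, THEN conjunct2])
    show "((\<lambda>i. \<bar>h k i - g k\<bar> * b k) \<longlongrightarrow> 0) F" for k
    proof -
      have "((\<lambda>i. \<bar>h k i - g k\<bar> * b k) \<longlongrightarrow> \<bar>g k - g k\<bar> * b k) F" by (intro tendsto_intros lim)
      then show ?thesis by simp
    qed
    show "\<forall>\<^sub>F (k, i) in sequentially \<times>\<^sub>F F. norm (\<bar>h k i - g k\<bar> * b k) \<le> 2 * (d k * b k)"
      unfolding eventually_prod_filter
      by (rule exI[of _ "\<lambda>_. True"], rule exI[of _ "\<lambda>i. \<forall>k. \<bar>h k i\<bar> \<le> d k"])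
        (use dom diff b(2) in auto)
    show "summable (\<lambda>k. 2 * (d k * b k))" using sm by (rule summable_mult)
  qed (rule \<open>F \<noteq> bot\<close>)
  then have "(\<delta> \<longlongrightarrow> 0) F" by (simp add: \<delta>_def[abs_def])
  moreover have "eventually (\<lambda>i. \<forall>x\<in>S. \<bar>(\<Sum>k. h k i * psi k x) - (\<Sum>k. g k * psi k x)\<bar> \<le> \<delta> i) F"
    using dom
  proof eventually_elim
    case (elim i)
    show ?case
    proof
      fix x assume "x \<in> S"
      have s1: "summable (\<lambda>k. h k i * psi k x)"
        by (rule summable_comparison_test'[OF sm, of 0])
          (use elim b \<open>x \<in> S\<close> in \<open>auto simp: abs_mult intro!: mult_mono order_trans[OF abs_ge_zero]\<close>)
      have s2: "summable (\<lambda>k. g k * psi k x)"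
        by (rule summable_comparison_test'[OF sm, of 0])
          (use g b \<open>x \<in> S\<close> in \<open>auto simp: abs_mult intro!: mult_mono order_trans[OF abs_ge_zero]\<close>)
      have s3: "summable (\<lambda>k. \<bar>h k i - g k\<bar> * b k)"
        by (rule summable_comparison_test'[OF summable_mult[OF sm, of 2], of 0])
          (use diff elim b(2) in auto)
      have "(\<Sum>k. h k i * psi k x) - (\<Sum>k. g k * psi k x) = (\<Sum>k. (h k i - g k) * psi k x)"
        using suminf_diff[OF s1 s2] by (simp add: algebra_simps)
      also have "norm \<dots> \<le> \<delta> i"
        unfolding \<delta>_def
        by (rule norm_suminf_le[OF _ s3])
          (use b \<open>x \<in> S\<close> in \<open>auto simp: abs_mult intro!: mult_left_mono\<close>)
      finally show "\<bar>(\<Sum>k. h k i * psi k x) - (\<Sum>k. g k * psi k x)\<bar> \<le> \<delta> i" by simp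
    qed
  qed
  ultimately show ?thesis using that by blast
qed

text \<open>The uniform bound is asked for almost everywhere only, because the kernels are
  controlled on the half line that carries \<open>mu q\<close>, not on all reals.\<close>

lemma integral_mult_uniform_tendsto:
  fixes r :: "'i \<Rightarrow> 'x \<Rightarrow> real" and f :: "'x \<Rightarrow> real"
  assumes f: "integrable M f"
    and r: "eventually (\<lambda>i. integrable M (\<lambda>x. r i x * f x)) F"
    and r0: "integrable M (\<lambda>x. r0 x * f x)"
    and unif: "eventually (\<lambda>i. AE x in M. \<bar>r i x - r0 x\<bar> \<le> \<delta> i) F"
    and \<delta>: "(\<delta> \<longlongrightarrow> 0) F"
  shows "((\<lambda>i. \<integral>x. r i x * f x \<partial>M) \<longlongrightarrow> (\<integral>x. r0 x * f x \<partial>M)) F"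
proof (rule LIM_zero_cancel, rule Lim_null_comparison)
  show "((\<lambda>i. \<delta> i * (\<integral>x. \<bar>f x\<bar> \<partial>M)) \<longlongrightarrow> 0) F"
    using tendsto_mult_right[OF \<delta>, of "\<integral>x. \<bar>f x\<bar> \<partial>M"] by simp
  show "eventually (\<lambda>i. norm ((\<integral>x. r i x * f x \<partial>M) - (\<integral>x. r0 x * f x \<partial>M))
      \<le> \<delta> i * (\<integral>x. \<bar>f x\<bar> \<partial>M)) F"
    using r unif
  proof eventually_elim
    case (elim i)
    have "(\<integral>x. r i x * f x \<partial>M) - (\<integral>x. r0 x * f x \<partial>M) = (\<integral>x. r i x * f x - r0 x * f x \<partial>M)"
      using elim r0 by simp
    also have "norm \<dots> \<le> (\<integral>x. norm (r i x * f x - r0 x * f x) \<partial>M)"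
      by (rule integral_norm_bound)
    also have "\<dots> \<le> (\<integral>x. \<delta> i * \<bar>f x\<bar> \<partial>M)"
    proof (rule integral_mono_AE)
      show "integrable M (\<lambda>x. norm (r i x * f x - r0 x * f x))"
        using elim r0 by (intro integrable_norm Bochner_Integration.integrable_diff)
      show "integrable M (\<lambda>x. \<delta> i * \<bar>f x\<bar>)" using f by (intro integrable_mult_right integrable_abs)
      show "AE x in M. norm (r i x * f x - r0 x * f x) \<le> \<delta> i * \<bar>f x\<bar>"
        using elim(2)
        by eventually_elim (auto simp: left_diff_distrib[symmetric] abs_mult intro!: mult_right_mono)
    qed
    finally show ?case by simp
  qed
qed

section \<open>Kernels started at finite points and at infinity\<close>

locale killed_diffusion_spectrum = entrance_drift +
  fixes psi dpsi :: "nat \<Rightarrow> real \<Rightarrow> real" and lam :: "nat \<Rightarrow> real"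
  assumes eig: "\<And>k. bounded_eigenfunction q q' (psi k) (dpsi k) (lam k)"
    and orth: "\<And>j k. integrable (mu q) (\<lambda>x. psi j x * psi k x)
                      \<and> (\<integral>x. psi j x * psi k x \<partial>mu q) = (if j = k then 1 else 0)"
    and psi_lim: "\<And>k. \<exists>L. (psi k \<longlongrightarrow> L) at_top"
begin

lemmas lam_pos = bounded_eigenfunction.l_pos[OF eig]
  and psi_cont = bounded_eigenfunction.f_cont[OF eig]
  and psi_measurable [measurable] = bounded_eigenfunction.f_measurable[OF eig]

lemma psi_tendsto: "(psi k \<longlongrightarrow> psi_inf psi k) at_top"
proof -
  obtain L where "(psi k \<longlongrightarrow> L) at_top" using psi_lim by blast
  moreover from this have "psi_inf psi k = L" unfolding psi_inf_def by (intro tendsto_Lim) auto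
  ultimately show ?thesis by simp
qed

lemma kernel_bounds:
  assumes "0 < s"
  obtains b where "\<And>k x. 0 \<le> x \<Longrightarrow> \<bar>psi k x\<bar> \<le> b k" "\<And>k. 0 \<le> b k"
    "\<And>k. \<bar>psi_inf psi k\<bar> \<le> b k" "summable (\<lambda>k. exp (- lam k * s) * b k * b k)"
proof -
  obtain b where b: "\<And>k x. 0 \<le> x \<Longrightarrow> \<bar>psi k x\<bar> \<le> b k" "\<And>k. 0 \<le> b k"
      "summable (\<lambda>k. exp (- lam k * s) * (b k)\<^sup>2)"
    using eigenfunction_sup_bounds[OF eig orth assms] by blast
  show ?thesis
  proof (rule that[of b])
    show "\<bar>psi_inf psi k\<bar> \<le> b k" for k
    proof (rule tendsto_upperbound[OF tendsto_rabs[OF psi_tendsto]])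
      show "eventually (\<lambda>x. \<bar>psi k x\<bar> \<le> b k) at_top"
        using eventually_ge_at_top[of 0] by eventually_elim (rule b(1))
    qed simp
  qed (use b in \<open>auto simp: power2_eq_square mult.assoc\<close>)
qed

text \<open>\<open>u\<close> stands for evaluation of the eigenfunctions at the starting point,
  finite or infinite; one majorant \<open>K\<close> serves both kernels.\<close>

lemma kernel_series_bound:
  assumes "0 < s"
  obtains K where "\<And>u k x. \<lbrakk>\<forall>k. u k = psi_inf psi k \<or> (\<exists>y\<ge>0. u k = psi k y); 0 \<le> x\<rbrakk> \<Longrightarrow>
      norm (exp (- lam k * s) * u k * psi k x) \<le> K k" "summable K"
proof -
  obtain b where b: "\<And>k x. 0 \<le> x \<Longrightarrow> \<bar>psi k x\<bar> \<le> b k" "\<And>k. 0 \<le> b k"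
    "\<And>k. \<bar>psi_inf psi k\<bar> \<le> b k" "summable (\<lambda>k. exp (- lam k * s) * b k * b k)"
    using kernel_bounds[OF assms] by blast
  show ?thesis
  proof (rule that[OF _ b(4)])
    fix u :: "nat \<Rightarrow> real" and k x
    assume u: "\<forall>k. u k = psi_inf psi k \<or> (\<exists>y\<ge>0. u k = psi k y)" and "(0::real) \<le> x"
    have "\<bar>u k\<bar> \<le> b k"
      using u[rule_format, of k]
    proof
      assume "u k = psi_inf psi k"
      then show ?thesis using b(3)[of k] by simp
    next
      assume "\<exists>y\<ge>0. u k = psi k y"
      then obtain y where "0 \<le> y" "u k = psi k y" by blast
      then show ?thesis using b(1)[of y k] by simp
    qed
    then have "exp (- lam k * s) * \<bar>u k\<bar> * \<bar>psi k x\<bar> \<le> exp (- lam k * s) * b k * b k"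
      using b(1)[OF \<open>0 \<le> x\<close>] b(2) by (intro mult_mono) auto
    then show "norm (exp (- lam k * s) * u k * psi k x) \<le> exp (- lam k * s) * b k * b k"
      by (simp add: abs_mult)
  qed
qed

lemma rker_inf_summable:
  assumes "0 < s" "0 \<le> x"
  shows "summable (\<lambda>k. exp (- lam k * s) * psi_inf psi k * psi k x)"
proof -
  obtain K where K: "\<And>u k x. \<lbrakk>\<forall>k. u k = psi_inf psi k \<or> (\<exists>y\<ge>0. u k = psi k y); 0 \<le> x\<rbrakk> \<Longrightarrow>
      norm (exp (- lam k * s) * u k * psi k x) \<le> K k" "summable K"
    using kernel_series_bound[OF assms(1)] by blast
  show ?thesis
    by (rule summable_comparison_test'[OF K(2), of 0]) (use K(1)[of "psi_inf psi"] assms in auto)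
qed

lemma kernels_bounded:
  assumes "0 < s"
  obtains C where "\<And>x. 0 \<le> x \<Longrightarrow> \<bar>rker_inf lam psi s x\<bar> \<le> C"
    "\<And>x y. 0 \<le> x \<Longrightarrow> 0 \<le> y \<Longrightarrow> \<bar>rker lam psi s y x\<bar> \<le> C"
proof -
  obtain K where K: "\<And>u k x. \<lbrakk>\<forall>k. u k = psi_inf psi k \<or> (\<exists>y\<ge>0. u k = psi k y); 0 \<le> x\<rbrakk> \<Longrightarrow>
      norm (exp (- lam k * s) * u k * psi k x) \<le> K k" "summable K"
    using kernel_series_bound[OF assms(1)] by blast
  have bound: "norm (\<Sum>k. exp (- lam k * s) * u k * psi k x) \<le> suminf K"
    if "\<forall>k. u k = psi_inf psi k \<or> (\<exists>y\<ge>0. u k = psi k y)" "0 \<le> x" for u x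
    by (rule norm_suminf_le[OF K(1)[OF that] K(2)])
  show ?thesis
  proof (rule that[of "suminf K"])
    show "\<bar>rker_inf lam psi s x\<bar> \<le> suminf K" if "0 \<le> x" for x
      using bound[of "psi_inf psi" x] that by (simp add: rker_inf_def)
    show "\<bar>rker lam psi s y x\<bar> \<le> suminf K" if "0 \<le> x" "0 \<le> y" for x y
      using bound[of "\<lambda>k. psi k y" x] that by (auto simp: rker_def)
  qed
qed

lemma rker_inf_cont:
  assumes "0 < s"
  shows "continuous_on {0..} (rker_inf lam psi s)"
proof -
  obtain K where K: "\<And>u k x. \<lbrakk>\<forall>k. u k = psi_inf psi k \<or> (\<exists>y\<ge>0. u k = psi k y); 0 \<le> x\<rbrakk> \<Longrightarrow>
      norm (exp (- lam k * s) * u k * psi k x) \<le> K k" "summable K"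
    using kernel_series_bound[OF assms(1)] by blast
  have "uniform_limit {0..} (\<lambda>n x. \<Sum>k<n. exp (- lam k * s) * psi_inf psi k * psi k x)
      (\<lambda>x. \<Sum>k. exp (- lam k * s) * psi_inf psi k * psi k x) sequentially"
    by (rule Weierstrass_m_test[OF _ K(2)]) (use K(1)[of "psi_inf psi"] in auto)
  then show ?thesis
    unfolding rker_inf_def[abs_def]
    by (rule uniform_limit_theorem[rotated])
      (auto intro!: always_eventually continuous_intros psi_cont)
qed

lemma rker_measurable [measurable]: "rker lam psi s y \<in> borel_measurable borel"
  unfolding rker_def[abs_def] by measurable

lemma rker_inf_measurable [measurable]: "rker_inf lam psi s \<in> borel_measurable borel"
  unfolding rker_inf_def[abs_def] by measurable

lemma rker_uniform_tendsto:
  assumes "0 < s"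
  obtains \<delta> where "(\<delta> \<longlongrightarrow> 0) at_top"
    "eventually (\<lambda>y. \<forall>x\<in>{0..}. \<bar>rker lam psi s y x - rker_inf lam psi s x\<bar> \<le> \<delta> y) at_top"
proof -
  obtain b where b: "\<And>k x. 0 \<le> x \<Longrightarrow> \<bar>psi k x\<bar> \<le> b k" "\<And>k. 0 \<le> b k"
    "\<And>k. \<bar>psi_inf psi k\<bar> \<le> b k" "summable (\<lambda>k. exp (- lam k * s) * b k * b k)"
    using kernel_bounds[OF assms] by blast
  note uniform = that
  show ?thesis
  proof (rule uniform_series_tendsto[where F = at_top and S = "{0..}" and psi = psi and b = b
        and h = "\<lambda>k y. exp (- lam k * s) * psi k y" and g = "\<lambda>k. exp (- lam k * s) * psi_inf psi k"
        and d = "\<lambda>k. exp (- lam k * s) * b k"])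
    show "eventually (\<lambda>y. \<forall>k. \<bar>exp (- lam k * s) * psi k y\<bar> \<le> exp (- lam k * s) * b k) at_top"
      using eventually_ge_at_top[of 0] by eventually_elim (use b(1) in \<open>simp add: abs_mult\<close>)
    show "((\<lambda>y. exp (- lam k * s) * psi k y) \<longlongrightarrow> exp (- lam k * s) * psi_inf psi k) at_top" for k
      by (intro tendsto_intros psi_tendsto)
    show thesis if "(\<delta> \<longlongrightarrow> 0) at_top" and
      "eventually (\<lambda>y. \<forall>x\<in>{0..}. \<bar>(\<Sum>k. exp (- lam k * s) * psi k y * psi k x)
        - (\<Sum>k. exp (- lam k * s) * psi_inf psi k * psi k x)\<bar> \<le> \<delta> y) at_top" for \<delta>
      using that by (intro uniform) (simp_all add: rker_def rker_inf_def)
    show "\<bar>psi k x\<bar> \<le> b k" if "x \<in> {0..}" for k x using that b(1) by simp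
  qed (use b(2,4) in simp_all)
qed

lemma rker_inf_time_uniform_tendsto:
  assumes "0 < t"
  obtains \<delta> where "(\<delta> \<longlongrightarrow> 0) (at t)"
    "eventually (\<lambda>s. \<forall>x\<in>{0..}. \<bar>rker_inf lam psi s x - rker_inf lam psi t x\<bar> \<le> \<delta> s) (at t)"
proof -
  \<comment> \<open>The majorant at time t / 2 dominates the series for all times s > t / 2, a
    neighbourhood of t.\<close>
  have half: "0 < t / 2" using assms by simp
  obtain b where b: "\<And>k x. 0 \<le> x \<Longrightarrow> \<bar>psi k x\<bar> \<le> b k" "\<And>k. 0 \<le> b k"
    "\<And>k. \<bar>psi_inf psi k\<bar> \<le> b k" "summable (\<lambda>k. exp (- lam k * (t / 2)) * b k * b k)"
    using kernel_bounds[OF half] by blast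
  note uniform = that
  show ?thesis
  proof (rule uniform_series_tendsto[where F = "at t" and S = "{0..}" and psi = psi and b = b
        and h = "\<lambda>k s. exp (- lam k * s) * psi_inf psi k" and g = "\<lambda>k. exp (- lam k * t) * psi_inf psi k"
        and d = "\<lambda>k. exp (- lam k * (t / 2)) * b k"])
    have "eventually (\<lambda>s. t / 2 < s) (at t)"
      using assms by (intro order_tendstoD(1)[OF tendsto_ident_at]) auto
    then show "eventually (\<lambda>s. \<forall>k. \<bar>exp (- lam k * s) * psi_inf psi k\<bar> \<le> exp (- lam k * (t / 2)) * b k) (at t)"
    proof eventually_elim
      case (elim s)
      have "exp (- lam k * s) * \<bar>psi_inf psi k\<bar> \<le> exp (- lam k * (t / 2)) * b k" for k
      proof (rule mult_mono)
        show "exp (- lam k * s) \<le> exp (- lam k * (t / 2))"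
          using mult_left_mono[of "t / 2" s "lam k"] elim lam_pos[of k] by simp
      qed (use b(2,3) in auto)
      then show ?case by (simp add: abs_mult)
    qed
    show "((\<lambda>s. exp (- lam k * s) * psi_inf psi k) \<longlongrightarrow> exp (- lam k * t) * psi_inf psi k) (at t)" for k
      by (intro tendsto_intros)
    show thesis if "(\<delta> \<longlongrightarrow> 0) (at t)" and
      "eventually (\<lambda>s. \<forall>x\<in>{0..}. \<bar>(\<Sum>k. exp (- lam k * s) * psi_inf psi k * psi k x)
        - (\<Sum>k. exp (- lam k * t) * psi_inf psi k * psi k x)\<bar> \<le> \<delta> s) (at t)" for \<delta>
      using that by (intro uniform) (simp_all add: rker_inf_def)
    show "\<bar>psi k x\<bar> \<le> b k" if "x \<in> {0..}" for k x using that b(1) by simp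
  qed (use b(2,4) in simp_all)
qed

lemma
  assumes "0 < s" and f: "integrable (mu q) f"
  shows integrable_rker_inf_mult: "integrable (mu q) (\<lambda>x. rker_inf lam psi s x * f x)"
    and integrable_rker_mult: "0 \<le> y \<Longrightarrow> integrable (mu q) (\<lambda>x. rker lam psi s y x * f x)"
    and integral_rker_tendsto: "((\<lambda>y. \<integral>x. rker lam psi s y x * f x \<partial>mu q) \<longlongrightarrow>
      (\<integral>x. rker_inf lam psi s x * f x \<partial>mu q)) at_top"
proof -
  obtain C where C: "\<And>x. 0 \<le> x \<Longrightarrow> \<bar>rker_inf lam psi s x\<bar> \<le> C"
    "\<And>x y. 0 \<le> x \<Longrightarrow> 0 \<le> y \<Longrightarrow> \<bar>rker lam psi s y x\<bar> \<le> C"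
    using kernels_bounded[OF \<open>0 < s\<close>] by blast
  have int: "integrable (mu q) (\<lambda>x. r x * f x)"
    if [measurable]: "r \<in> borel_measurable borel" and r: "\<And>x. 0 \<le> x \<Longrightarrow> \<bar>r x\<bar> \<le> C" for r
  proof (rule Bochner_Integration.integrable_bound)
    show "integrable (mu q) (\<lambda>x. C * f x)" using f by simp
    show "(\<lambda>x. r x * f x) \<in> borel_measurable (mu q)"
      using borel_measurable_integrable[OF f] by measurable
    show "AE x in mu q. norm (r x * f x) \<le> norm (C * f x)"
      using AE_mu_nonneg
    proof eventually_elim
      case (elim x)
      have "\<bar>r x\<bar> * \<bar>f x\<bar> \<le> \<bar>C\<bar> * \<bar>f x\<bar>"
        using r[OF elim] by (intro mult_right_mono) auto
      then show ?case by (simp add: abs_mult)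
    qed
  qed
  show inf: "integrable (mu q) (\<lambda>x. rker_inf lam psi s x * f x)" by (intro int C) auto
  show fin: "integrable (mu q) (\<lambda>x. rker lam psi s y x * f x)" if "0 \<le> y" for y
    using that by (intro int C) auto
  obtain \<delta> where \<delta>: "(\<delta> \<longlongrightarrow> 0) at_top"
    "eventually (\<lambda>y. \<forall>x\<in>{0..}. \<bar>rker lam psi s y x - rker_inf lam psi s x\<bar> \<le> \<delta> y) at_top"
    using rker_uniform_tendsto[OF \<open>0 < s\<close>] by blast
  show "((\<lambda>y. \<integral>x. rker lam psi s y x * f x \<partial>mu q) \<longlongrightarrow>
      (\<integral>x. rker_inf lam psi s x * f x \<partial>mu q)) at_top"
  proof (rule integral_mult_uniform_tendsto[OF f _ inf _ \<delta>(1)])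
    show "eventually (\<lambda>y. integrable (mu q) (\<lambda>x. rker lam psi s y x * f x)) at_top"
      using eventually_ge_at_top[of 0] by eventually_elim (rule fin)
    show "eventually (\<lambda>y. AE x in mu q. \<bar>rker lam psi s y x - rker_inf lam psi s x\<bar> \<le> \<delta> y) at_top"
      using \<delta>(2) by eventually_elim (use AE_mu_nonneg in \<open>auto elim!: eventually_mono\<close>)
  qed
qed

text \<open>This integral is the limit of the survival probabilities up to time s; its continuity
  excludes an atom of the limiting hitting time.\<close>

lemma isCont_integral_rker_inf:
  assumes "0 < t"
  shows "isCont (\<lambda>s. \<integral>x. rker_inf lam psi s x \<partial>mu q) t"
proof -
  have one: "integrable (mu q) (\<lambda>x. 1 :: real)" by simp
  obtain \<delta> where \<delta>: "(\<delta> \<longlongrightarrow> 0) (at t)"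
    "eventually (\<lambda>s. \<forall>x\<in>{0..}. \<bar>rker_inf lam psi s x - rker_inf lam psi t x\<bar> \<le> \<delta> s) (at t)"
    using rker_inf_time_uniform_tendsto[OF assms] by blast
  have "((\<lambda>s. \<integral>x. rker_inf lam psi s x * 1 \<partial>mu q) \<longlongrightarrow> (\<integral>x. rker_inf lam psi t x * 1 \<partial>mu q)) (at t)"
  proof (rule integral_mult_uniform_tendsto[OF one _ _ _ \<delta>(1)])
    have "eventually (\<lambda>s. 0 < s) (at t)"
      using assms by (intro order_tendstoD(1)[OF tendsto_ident_at])
    then show "eventually (\<lambda>s. integrable (mu q) (\<lambda>x. rker_inf lam psi s x * 1)) (at t)"
      by eventually_elim (intro integrable_rker_inf_mult one)
    show "integrable (mu q) (\<lambda>x. rker_inf lam psi t x * 1)"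
      by (intro integrable_rker_inf_mult one assms)
    show "eventually (\<lambda>s. AE x in mu q. \<bar>rker_inf lam psi s x - rker_inf lam psi t x\<bar> \<le> \<delta> s) (at t)"
      using \<delta>(2) by eventually_elim (use AE_mu_nonneg in \<open>auto elim!: eventually_mono\<close>)
  qed
  then show ?thesis by (simp add: isCont_def)
qed

lemma rker_Lp_tendsto:
  assumes "0 < t" "1 \<le> p"
  shows "((\<lambda>y. \<integral>\<^sup>+ x. ennreal (\<bar>rker lam psi t y x - rker_inf lam psi t x\<bar> powr p) \<partial>mu q) \<longlongrightarrow> 0) at_top"
proof -
  obtain \<delta> where \<delta>: "(\<delta> \<longlongrightarrow> 0) at_top"
    "eventually (\<lambda>y. \<forall>x\<in>{0..}. \<bar>rker lam psi t y x - rker_inf lam psi t x\<bar> \<le> \<delta> y) at_top"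
    using rker_uniform_tendsto[OF assms(1)] by blast
  \<comment> \<open>Once the uniform distance is below 1, its p-th power is at most the distance
    itself, and the total mass of \<open>mu q\<close> is finite.\<close>
  have "eventually (\<lambda>y. \<delta> y < 1) at_top" using order_tendstoD(2)[OF \<delta>(1)] by simp
  with \<delta>(2) have bound: "eventually (\<lambda>y. (\<integral>\<^sup>+ x. ennreal (\<bar>rker lam psi t y x - rker_inf lam psi t x\<bar> powr p) \<partial>mu q)
      \<le> ennreal (\<delta> y * measure (mu q) UNIV)) at_top"
  proof eventually_elim
    case (elim y)
    have "0 \<le> \<delta> y" using elim(1)[rule_format, of 0] by auto
    have "AE x in mu q. ennreal (\<bar>rker lam psi t y x - rker_inf lam psi t x\<bar> powr p) \<le> ennreal (\<delta> y)"
      using AE_mu_nonneg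
    proof eventually_elim
      fix x :: real assume "0 \<le> x"
      then have le: "\<bar>rker lam psi t y x - rker_inf lam psi t x\<bar> \<le> \<delta> y" using elim by simp
      then have "\<bar>rker lam psi t y x - rker_inf lam psi t x\<bar> powr p
          \<le> \<bar>rker lam psi t y x - rker_inf lam psi t x\<bar> powr 1"
        using elim(2) \<open>1 \<le> p\<close> by (intro powr_mono') auto
      then show "ennreal (\<bar>rker lam psi t y x - rker_inf lam psi t x\<bar> powr p) \<le> ennreal (\<delta> y)"
        using le by (intro ennreal_leI) simp
    qed
    then have "(\<integral>\<^sup>+ x. ennreal (\<bar>rker lam psi t y x - rker_inf lam psi t x\<bar> powr p) \<partial>mu q)
        \<le> (\<integral>\<^sup>+ x. ennreal (\<delta> y) \<partial>mu q)" by (rule nn_integral_mono_AE)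
    also have "\<dots> = ennreal (\<delta> y * measure (mu q) UNIV)"
      using \<open>0 \<le> \<delta> y\<close> by (simp add: emeasure_eq_measure ennreal_mult')
    finally show ?case .
  qed
  have "((\<lambda>y. ennreal (\<delta> y * measure (mu q) UNIV)) \<longlongrightarrow> ennreal (0 * measure (mu q) UNIV)) at_top"
    by (intro tendsto_ennrealI tendsto_intros \<delta>(1))
  then have lim: "((\<lambda>y. ennreal (\<delta> y * measure (mu q) UNIV)) \<longlongrightarrow> 0) at_top" by simp
  show ?thesis
    by (rule tendsto_sandwich[OF _ bound tendsto_const lim]) simp
qed

lemma integrable_rker_inf_powr:
  assumes "0 < t" "1 \<le> p"
  shows "integrable (mu q) (\<lambda>x. \<bar>rker_inf lam psi t x\<bar> powr p)"
proof -
  obtain C where C: "\<And>x. 0 \<le> x \<Longrightarrow> \<bar>rker_inf lam psi t x\<bar> \<le> C"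
    "\<And>x y. 0 \<le> x \<Longrightarrow> 0 \<le> y \<Longrightarrow> \<bar>rker lam psi t y x\<bar> \<le> C"
    using kernels_bounded[OF \<open>0 < t\<close>] by blast
  show ?thesis
  proof (rule integrable_const_bound[where B = "C powr p"])
    show "AE x in mu q. norm (\<bar>rker_inf lam psi t x\<bar> powr p) \<le> C powr p"
      using AE_mu_nonneg by eventually_elim (use C assms in \<open>auto intro!: powr_mono2\<close>)
  qed measurable
qed

end

section \<open>Convergence of laws\<close>

text \<open>Tested on the set where \<open>h\<close> is negative. It turns the nonnegativity of
  probabilities into that of the kernel.\<close>

lemma AE_nonneg_of_integrals:
  fixes h :: "'a \<Rightarrow> real"
  assumes h: "integrable N h"
    and nonneg: "\<And>A. A \<in> sets N \<Longrightarrow> 0 \<le> (\<integral>x. indicator A x * h x \<partial>N)"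
  shows "AE x in N. 0 \<le> h x"
proof -
  have [measurable]: "h \<in> borel_measurable N" using h by simp
  define A where "A = {x\<in>space N. h x < 0}"
  have [measurable]: "A \<in> sets N" unfolding A_def by measurable
  have int: "integrable N (\<lambda>x. - (indicator A x * h x))"
    using integrable_mult_indicator[OF \<open>A \<in> sets N\<close> h] by simp
  have pos: "AE x in N. 0 \<le> - (indicator A x * h x)"
    by (auto simp: A_def split: split_indicator)
  have "(\<integral>x. - (indicator A x * h x) \<partial>N) = 0"
    using nonneg[OF \<open>A \<in> sets N\<close>] integral_nonneg_AE[OF pos] by simp
  then have "AE x in N. - (indicator A x * h x) = 0"
    using integral_nonneg_eq_0_iff_AE[OF int pos] by simp
  then show ?thesis
    using AE_space by eventually_elim (auto simp: A_def split: split_indicator_asm)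
qed

text \<open>The law of \<open>Y\<close> on \<open>E\<close> and the measure with density
  \<open>h\<close> are finite and agree on half-lines, hence coincide. The sign of \<open>h\<close>
  is needed because densities are \<open>ennreal\<close>-valued. If \<open>f\<close> is not
  integrable for this measure, both sides are 0 by convention.\<close>

lemma integral_restricted_law:
  fixes Y :: "'a \<Rightarrow> real" and h f :: "real \<Rightarrow> real"
  assumes "finite_measure M" and [measurable]: "Y \<in> borel_measurable M" "E \<in> sets M"
    and sN [simp, measurable_cong]: "sets N = sets borel"
    and h: "integrable N h" "AE x in N. 0 \<le> h x"
    and law: "\<And>c. measure M {\<omega>\<in>space M. c < Y \<omega> \<and> \<omega> \<in> E} = (\<integral>x. indicator {c<..} x * h x \<partial>N)"
    and [measurable]: "f \<in> borel_measurable borel"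
  shows "(\<integral>\<omega>. indicator E \<omega> * f (Y \<omega>) \<partial>M) = (\<integral>x. h x * f x \<partial>N)"
proof -
  interpret finite_measure M by fact
  have [measurable]: "h \<in> borel_measurable N" using h by simp
  then have hb [measurable]: "h \<in> borel_measurable borel" by (simp cong: measurable_cong_sets)
  define \<nu> where "\<nu> = distr (density M (\<lambda>\<omega>. ennreal (indicator E \<omega>))) borel Y"
  have \<nu>: "emeasure \<nu> {c<..} = ennreal (\<integral>x. indicator {c<..} x * h x \<partial>N)" for c
  proof -
    have "emeasure \<nu> {c<..} = emeasure (density M (\<lambda>\<omega>. ennreal (indicator E \<omega>))) (Y -` {c<..} \<inter> space M)"
      unfolding \<nu>_def by (subst emeasure_distr) auto
    also have "\<dots> = (\<integral>\<^sup>+ \<omega>. ennreal (indicator E \<omega>) * indicator (Y -` {c<..} \<inter> space M) \<omega> \<partial>M)"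
      by (intro emeasure_density) measurable
    also have "\<dots> = (\<integral>\<^sup>+ \<omega>. indicator {\<omega>\<in>space M. c < Y \<omega> \<and> \<omega> \<in> E} \<omega> \<partial>M)"
      by (intro nn_integral_cong) (auto split: split_indicator)
    also have "\<dots> = emeasure M {\<omega>\<in>space M. c < Y \<omega> \<and> \<omega> \<in> E}"
      by (intro nn_integral_indicator) measurable
    also have "\<dots> = ennreal (\<integral>x. indicator {c<..} x * h x \<partial>N)"
      by (simp add: emeasure_eq_measure law)
    finally show ?thesis .
  qed
  have "\<nu> = density N (\<lambda>x. ennreal (h x))"
  proof (rule measure_eqI_lessThan)
    show "emeasure \<nu> {c<..} < \<infinity>" for c by (simp add: \<nu>)
    show "emeasure \<nu> {c<..} = emeasure (density N (\<lambda>x. ennreal (h x))) {c<..}" for c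
    proof -
      have "emeasure (density N (\<lambda>x. ennreal (h x))) {c<..} = (\<integral>\<^sup>+ x. ennreal (indicator {c<..} x * h x) \<partial>N)"
        by (subst emeasure_density) (auto intro!: nn_integral_cong split: split_indicator)
      also have "\<dots> = ennreal (\<integral>x. indicator {c<..} x * h x \<partial>N)"
      proof (rule nn_integral_eq_integral)
        show "integrable N (\<lambda>x. indicator {c<..} x * h x)"
          using integrable_mult_indicator[OF _ h(1), of "{c<..}"] by simp
        show "AE x in N. 0 \<le> indicator {c<..} x * h x"
          using h(2) by eventually_elim auto
      qed
      finally show ?thesis using \<nu> by simp
    qed
  qed (auto simp: \<nu>_def)
  moreover have "integral\<^sup>L \<nu> f = (\<integral>\<omega>. indicator E \<omega> * f (Y \<omega>) \<partial>M)"
    unfolding \<nu>_def by (subst integral_distr) (auto simp: integral_density)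
  moreover have "integral\<^sup>L (density N (\<lambda>x. ennreal (h x))) f = (\<integral>x. h x * f x \<partial>N)"
    using h(2) by (subst integral_density) auto
  ultimately show ?thesis by simp
qed

text \<open>Almost sure convergence of \<open>Y n\<close> passes through continuous test functions
  only. So n tends to infinity first, for a fixed ramp, and the ramps then increase to the indicator
  of the half-line.\<close>

lemma restricted_law_limit:
  fixes Y :: "nat \<Rightarrow> 'a \<Rightarrow> real" and r :: "nat \<Rightarrow> real \<Rightarrow> real" and N :: "real measure"
  assumes "finite_measure M"
    and [measurable]: "\<And>n. Y n \<in> borel_measurable M" "\<And>n. E n \<in> sets M"
      "Yinf \<in> borel_measurable M" "Einf \<in> sets M"
    and sN [simp, measurable_cong]: "sets N = sets borel"
    and Y_lim: "AE \<omega> in M. (\<lambda>n. Y n \<omega>) \<longlonglongrightarrow> Yinf \<omega>"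
    and E_lim: "AE \<omega> in M. eventually (\<lambda>n. \<omega> \<in> E n \<longleftrightarrow> \<omega> \<in> Einf) sequentially"
    and law: "\<And>n f. f \<in> borel_measurable borel \<Longrightarrow>
      (\<integral>\<omega>. indicator (E n) \<omega> * f (Y n \<omega>) \<partial>M) = (\<integral>x. r n x * f x \<partial>N)"
    and r_lim: "\<And>f. f \<in> borel_measurable borel \<Longrightarrow> bounded (range f) \<Longrightarrow>
      (\<lambda>n. \<integral>x. r n x * f x \<partial>N) \<longlonglongrightarrow> (\<integral>x. rinf x * f x \<partial>N)"
    and r_inf: "integrable N rinf"
  shows "measure M {\<omega>\<in>space M. c < Yinf \<omega> \<and> \<omega> \<in> Einf} = (\<integral>x. indicator {c<..} x * rinf x \<partial>N)"
proof -
  interpret finite_measure M by fact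
  \<comment> \<open>A ramp that is 0 up to c and, for m > 0, equal to 1 from c + 1/m on.\<close>
  define f where "f m x = min 1 (max 0 (real m * (x - c)))" for m x
  have f_cont: "continuous_on UNIV (f m)" for m
    unfolding f_def[abs_def] by (intro continuous_intros)
  then have [measurable]: "f m \<in> borel_measurable borel" for m
    by (intro borel_measurable_continuous_onI)
  have f_le: "\<bar>f m x\<bar> \<le> 1" for m x by (auto simp: f_def)
  have f_lim: "(\<lambda>m. f m x) \<longlonglongrightarrow> indicator {c<..} x" for x
  proof (cases "c < x")
    case True
    obtain k where "1 < real k * (x - c)" using True reals_Archimedean3[of "x - c"] by auto
    then have "eventually (\<lambda>m. f m x = 1) sequentially"
      unfolding eventually_sequentially
    proof (intro exI[of _ k] allI impI)
      fix m assume "k \<le> m"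
      then have "real k * (x - c) \<le> real m * (x - c)" using True by (intro mult_right_mono) auto
      then show "f m x = 1" using \<open>1 < real k * (x - c)\<close> by (simp add: f_def)
    qed
    then show ?thesis using True by (simp add: tendsto_eventually)
  next
    case False
    then have "f m x = 0" for m by (simp add: f_def mult_nonneg_nonpos)
    then show ?thesis using False by simp
  qed
  have eq: "(\<integral>\<omega>. indicator Einf \<omega> * f m (Yinf \<omega>) \<partial>M) = (\<integral>x. rinf x * f m x \<partial>N)" for m
  proof (rule LIMSEQ_unique)
    show "(\<lambda>n. \<integral>\<omega>. indicator (E n) \<omega> * f m (Y n \<omega>) \<partial>M)
        \<longlonglongrightarrow> (\<integral>\<omega>. indicator Einf \<omega> * f m (Yinf \<omega>) \<partial>M)"
    proof (rule integral_dominated_convergence[where w = "\<lambda>_. 1"])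
      show "AE \<omega> in M. (\<lambda>n. indicator (E n) \<omega> * f m (Y n \<omega>)) \<longlonglongrightarrow> indicator Einf \<omega> * f m (Yinf \<omega>)"
        using Y_lim E_lim
      proof eventually_elim
        case (elim \<omega>)
        have "isCont (f m) (Yinf \<omega>)" using f_cont by (simp add: continuous_on_eq_continuous_at)
        then have "(\<lambda>n. f m (Y n \<omega>)) \<longlonglongrightarrow> f m (Yinf \<omega>)" using elim(1) by (rule isCont_tendsto_compose)
        moreover have "(\<lambda>n. indicator (E n) \<omega> :: real) \<longlonglongrightarrow> indicator Einf \<omega>"
          using elim(2) by (intro tendsto_eventually) (auto elim!: eventually_mono split: split_indicator)
        ultimately show ?case by (intro tendsto_mult)
      qed
      show "AE \<omega> in M. norm (indicator (E n) \<omega> * f m (Y n \<omega>)) \<le> 1" for n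
        using f_le by (auto split: split_indicator)
    qed auto
    have "bounded (range (f m))" unfolding bounded_iff using f_le by (auto intro!: exI[of _ 1])
    then show "(\<lambda>n. \<integral>\<omega>. indicator (E n) \<omega> * f m (Y n \<omega>) \<partial>M) \<longlonglongrightarrow> (\<integral>x. rinf x * f m x \<partial>N)"
      by (subst law) (auto intro: r_lim)
  qed
  have "(\<lambda>m. \<integral>\<omega>. indicator Einf \<omega> * f m (Yinf \<omega>) \<partial>M)
      \<longlonglongrightarrow> (\<integral>\<omega>. indicator Einf \<omega> * indicator {c<..} (Yinf \<omega>) \<partial>M)"
  proof (rule integral_dominated_convergence[where w = "\<lambda>_. 1"])
    show "AE \<omega> in M. (\<lambda>m. indicator Einf \<omega> * f m (Yinf \<omega>)) \<longlonglongrightarrow> indicator Einf \<omega> * indicator {c<..} (Yinf \<omega>)"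
      by (intro AE_I2 tendsto_intros f_lim)
    show "AE \<omega> in M. norm (indicator Einf \<omega> * f m (Yinf \<omega>)) \<le> 1" for m
      using f_le by (auto split: split_indicator)
  qed auto
  moreover have "(\<integral>\<omega>. indicator Einf \<omega> * indicator {c<..} (Yinf \<omega>) \<partial>M)
      = measure M {\<omega>\<in>space M. c < Yinf \<omega> \<and> \<omega> \<in> Einf}"
  proof -
    have "(\<integral>\<omega>. indicator Einf \<omega> * indicator {c<..} (Yinf \<omega>) \<partial>M)
        = (\<integral>\<omega>. indicator {\<omega>\<in>space M. c < Yinf \<omega> \<and> \<omega> \<in> Einf} \<omega> \<partial>M :: real)"
      by (intro Bochner_Integration.integral_cong) (auto split: split_indicator)
    also have "\<dots> = measure M {\<omega>\<in>space M. c < Yinf \<omega> \<and> \<omega> \<in> Einf}"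
      by (simp add: Int_absorb2 subset_eq)
    finally show ?thesis .
  qed
  moreover have "(\<lambda>m. \<integral>x. rinf x * f m x \<partial>N) \<longlonglongrightarrow> (\<integral>x. rinf x * indicator {c<..} x \<partial>N)"
  proof (rule integral_dominated_convergence[where w = "\<lambda>x. \<bar>rinf x\<bar>"])
    show "AE x in N. norm (rinf x * f m x) \<le> \<bar>rinf x\<bar>" for m
      using f_le by (auto simp: abs_mult mult_left_le)
    show "AE x in N. (\<lambda>m. rinf x * f m x) \<longlonglongrightarrow> rinf x * indicator {c<..} x"
      by (intro AE_I2 tendsto_intros f_lim)
  qed (use r_inf in auto)
  ultimately show ?thesis
    unfolding eq by (metis (no_types, lifting) LIMSEQ_unique mult.commute Bochner_Integration.integral_cong)
qed

text \<open>If T = t lies strictly between two times, then almost surely the approximating times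
  eventually do too. The mass at t is therefore at most the difference of \<open>g\<close> at those
  times, which continuity makes small.\<close>

lemma AE_limit_time_neq:
  fixes \<tau> :: "nat \<Rightarrow> 'a \<Rightarrow> ereal" and T :: "'a \<Rightarrow> ereal" and g :: "real \<Rightarrow> real"
  assumes "finite_measure M" and [measurable]: "T \<in> borel_measurable M"
    and \<tau>_meas: "\<And>n s. 0 \<le> s \<Longrightarrow> {\<omega>\<in>space M. ereal s < \<tau> n \<omega>} \<in> sets M"
    and \<tau>_lim: "AE \<omega> in M. (\<lambda>n. \<tau> n \<omega>) \<longlonglongrightarrow> T \<omega>"
    and law: "\<And>s. 0 < s \<Longrightarrow> (\<lambda>n. measure M {\<omega>\<in>space M. ereal s < \<tau> n \<omega>}) \<longlonglongrightarrow> g s"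
    and g: "isCont g t" and "0 < t"
  shows "AE \<omega> in M. T \<omega> \<noteq> ereal t"
proof -
  interpret finite_measure M by fact
  define B where "B = {\<omega>\<in>space M. T \<omega> = ereal t}"
  have B [measurable]: "B \<in> sets M" unfolding B_def by measurable
  have le: "measure M B \<le> g s\<^sub>1 - g s\<^sub>2" if s: "0 < s\<^sub>1" "s\<^sub>1 < t" "t < s\<^sub>2" for s\<^sub>1 s\<^sub>2
  proof -
    define A where "A s n = {\<omega>\<in>space M. ereal s < \<tau> n \<omega>}" for s n
    have A_sets: "A s n \<in> sets M" if "0 < s" for s n
      unfolding A_def by (rule \<tau>_meas) (use that in simp)
    have [measurable]: "A s\<^sub>1 n \<in> sets M" "A s\<^sub>2 n \<in> sets M" for n
      using s by (simp_all add: A_sets)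
    have "(\<lambda>n. \<integral>\<omega>. indicator B \<omega> * indicator (A s\<^sub>1 n - A s\<^sub>2 n) \<omega> \<partial>M) \<longlonglongrightarrow> (\<integral>\<omega>. indicator B \<omega> \<partial>M :: real)"
    proof (rule integral_dominated_convergence[where w = "\<lambda>_. 1"])
      show "AE \<omega> in M. (\<lambda>n. indicator B \<omega> * indicator (A s\<^sub>1 n - A s\<^sub>2 n) \<omega>) \<longlonglongrightarrow> (indicator B \<omega> :: real)"
        using \<tau>_lim AE_space
      proof eventually_elim
        case (elim \<omega>)
        show ?case
        proof (cases "\<omega> \<in> B")
          case True
          then have "T \<omega> = ereal t" by (simp add: B_def)
          then have "eventually (\<lambda>n. ereal s\<^sub>1 < \<tau> n \<omega>) sequentially" "eventually (\<lambda>n. \<tau> n \<omega> < ereal s\<^sub>2) sequentially"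
            using order_tendstoD[OF elim(1)] s by auto
          then have "eventually (\<lambda>n. indicator B \<omega> * indicator (A s\<^sub>1 n - A s\<^sub>2 n) \<omega> = (indicator B \<omega> :: real)) sequentially"
            by eventually_elim (use elim(2) True in \<open>auto simp: A_def\<close>)
          then show ?thesis by (rule tendsto_eventually)
        qed simp
      qed
    qed (auto split: split_indicator)
    moreover have "(\<integral>\<omega>. indicator B \<omega> * indicator (A s\<^sub>1 n - A s\<^sub>2 n) \<omega> \<partial>M) \<le> measure M (A s\<^sub>1 n) - measure M (A s\<^sub>2 n)" for n
    proof -
      have "(\<integral>\<omega>. indicator B \<omega> * indicator (A s\<^sub>1 n - A s\<^sub>2 n) \<omega> \<partial>M) = measure M (B \<inter> (A s\<^sub>1 n - A s\<^sub>2 n))"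
        by (simp add: indicator_inter_arith[symmetric] A_def Int_absorb2 subset_eq)
      also have "\<dots> \<le> measure M (A s\<^sub>1 n - A s\<^sub>2 n)" by (intro finite_measure_mono) auto
      also have "\<dots> = measure M (A s\<^sub>1 n) - measure M (A s\<^sub>2 n)"
      proof (intro finite_measure_Diff A_sets)
        show "A s\<^sub>2 n \<subseteq> A s\<^sub>1 n"
          using s by (auto simp: A_def intro: less_trans[of "ereal s\<^sub>1" "ereal s\<^sub>2"])
      qed (use s in auto)
      finally show ?thesis .
    qed
    moreover have "(\<lambda>n. measure M (A s\<^sub>1 n) - measure M (A s\<^sub>2 n)) \<longlonglongrightarrow> g s\<^sub>1 - g s\<^sub>2"
      unfolding A_def using s by (intro tendsto_diff law) auto
    ultimately have "(\<integral>\<omega>. indicator B \<omega> \<partial>M) \<le> g s\<^sub>1 - g s\<^sub>2" by (intro LIMSEQ_le) auto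
    then show ?thesis by (simp add: B_def Int_absorb2 subset_eq)
  qed
  have "measure M B \<le> e" if "0 < e" for e
  proof -
    have "0 < e / 2" using that by simp
    then obtain d where d: "0 < d" "\<forall>s. dist s t < d \<longrightarrow> dist (g s) (g t) < e / 2"
      using g unfolding continuous_at_eps_delta by blast
    \<comment> \<open>Half of each bound keeps t - h positive and both times within d of t.\<close>
    define h where "h = min (d / 2) (t / 2)"
    have "0 < h" "h < d" "h < t" using d \<open>0 < t\<close> by (auto simp: h_def)
    then have "measure M B \<le> g (t - h) - g (t + h)" by (intro le) auto
    also have "\<dots> \<le> e"
    proof -
      have "\<bar>g (t - h) - g t\<bar> < e / 2" "\<bar>g (t + h) - g t\<bar> < e / 2"
        using d(2) \<open>0 < h\<close> \<open>h < d\<close> by (auto simp: dist_real_def)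
      then show ?thesis by linarith
    qed
    finally show ?thesis .
  qed
  then have "measure M B \<le> 0" by (rule field_le_epsilon[of _ 0, simplified])
  then have "emeasure M B = 0" by (simp add: emeasure_eq_measure measure_le_0_iff)
  then show ?thesis by (subst AE_iff_measurable[OF B]) (auto simp: B_def)
qed

text \<open>For a stopped path, survival past s can be read off at time s alone; this makes the
  survival event measurable.\<close>

lemma hit0_gt_iff:
  assumes cont: "continuous_on {0..} (\<lambda>s. X x s \<omega>)"
    and stopped: "\<And>s. 0 \<le> s \<Longrightarrow> hit0 X x \<omega> < ereal s \<Longrightarrow> X x s \<omega> = 0"
    and "0 \<le> s"
  shows "ereal s < hit0 X x \<omega> \<longleftrightarrow> X x s \<omega> \<noteq> 0"
proof
  assume "ereal s < hit0 X x \<omega>"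
  show "X x s \<omega> \<noteq> 0"
  proof
    assume "X x s \<omega> = 0"
    then have "hit0 X x \<omega> \<le> ereal s" unfolding hit0_def using \<open>0 \<le> s\<close> by (intro Inf_lower) auto
    then show False using \<open>ereal s < hit0 X x \<omega>\<close> by simp
  qed
next
  assume ne: "X x s \<omega> \<noteq> 0"
  show "ereal s < hit0 X x \<omega>"
  proof (rule ccontr)
    assume "\<not> ereal s < hit0 X x \<omega>"
    then have le: "hit0 X x \<omega> \<le> ereal s" by simp
    \<comment> \<open>The critical case: the infimum would be s although the path is nonzero there.
      By continuity there is no zero within some d of s, so the infimum is at least s + d.\<close>
    have eq: "hit0 X x \<omega> = ereal s" using le stopped[OF \<open>0 \<le> s\<close>] ne by (auto simp: order_le_less)
    have "((\<lambda>u. X x u \<omega>) \<longlongrightarrow> X x s \<omega>) (at s within {0..})"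
      using cont \<open>0 \<le> s\<close> by (auto simp: continuous_on_def)
    from tendsto_imp_eventually_ne[OF this ne]
    obtain d where d: "0 < d" "\<And>u. 0 \<le> u \<Longrightarrow> u \<noteq> s \<Longrightarrow> dist u s < d \<Longrightarrow> X x u \<omega> \<noteq> 0"
      by (auto simp: eventually_at)
    have "ereal (s + d) \<le> hit0 X x \<omega>"
      unfolding hit0_def
    proof (rule Inf_greatest)
      fix z assume "z \<in> {ereal s |s. 0 \<le> s \<and> X x s \<omega> = 0}"
      then obtain u where u: "z = ereal u" "0 \<le> u" "X x u \<omega> = 0" by auto
      then have "hit0 X x \<omega> \<le> ereal u" unfolding hit0_def by (intro Inf_lower) auto
      then have "s \<le> u" by (simp add: eq)
      moreover have "u \<noteq> s" using u ne by auto
      then have "\<not> dist u s < d" using d(2) u by blast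
      ultimately show "ereal (s + d) \<le> z" using u by (simp add: dist_real_def)
    qed
    then show False using eq d(1) by simp
  qed
qed

theorem theorem1p7:
  fixes M :: "'a measure"
    and B :: "real \<Rightarrow> 'a \<Rightarrow> real"
    and q q' :: "real \<Rightarrow> real"
    and X :: "real \<Rightarrow> real \<Rightarrow> 'a \<Rightarrow> real"
    and Xinf :: "real \<Rightarrow> 'a \<Rightarrow> real"
    and Tinf :: "'a \<Rightarrow> ereal"
    and lam :: "nat \<Rightarrow> real"
    and psi :: "nat \<Rightarrow> real \<Rightarrow> real"
    and t :: real
  assumes BM: "std_BM M B"
    (* q in C^1([0,oo)) with derivative q' *)
    and q_deriv: "\<And>x. 0 \<le> x \<Longrightarrow> (q has_real_derivative q' x) (at x within {0..})"
    and q'_cont: "continuous_on {0..} q'"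
    (* X^x solves dX = dB - q(X) dt, X_0 = x, stopped at 0 (pathwise, additive noise) *)
    and X_meas: "\<And>x s. 0 \<le> x \<Longrightarrow> X x s \<in> borel_measurable M"
    and X_cont: "\<And>x \<omega>. 0 \<le> x \<Longrightarrow> \<omega> \<in> space M \<Longrightarrow> continuous_on {0..} (\<lambda>s. X x s \<omega>)"
    and X_sde: "\<And>x \<omega> s. 0 \<le> x \<Longrightarrow> \<omega> \<in> space M \<Longrightarrow> 0 \<le> s \<Longrightarrow>
        (ereal s \<le> hit0 X x \<omega> \<longrightarrow> X x s \<omega> = x + B s \<omega> - integral {0..s} (\<lambda>u. q (X x u \<omega>)))
      \<and> (hit0 X x \<omega> < ereal s \<longrightarrow> X x s \<omega> = 0)"
    (* X^oo_s = lim_{x -> oo} X^x_{s /\ T^x_0}, T^oo_0 = lim_x T^x_0 (a.s.) *)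
    and Xinf_meas: "\<And>s. Xinf s \<in> borel_measurable M"
    and Xinf_lim: "\<And>s. 0 < s \<Longrightarrow> AE \<omega> in M. ((\<lambda>x. X x s \<omega>) \<longlongrightarrow> Xinf s \<omega>) at_top"
    and Tinf_meas: "Tinf \<in> borel_measurable M"
    and Tinf_lim: "AE \<omega> in M. ((\<lambda>x. hit0 X x \<omega>) \<longlongrightarrow> Tinf \<omega>) at_top"
    (* (H1) *)
    and H1: "(\<integral>\<^sup>+ y. indicator {0..} y * ennreal (exp (gam q y)) *
               (\<integral>\<^sup>+ \<xi>. indicator {y..} \<xi> * ennreal (exp (- gam q \<xi>)) \<partial>lborel) \<partial>lborel) < \<infinity>"
    (* (H2) *)
    and H2a: "filterlim q at_top at_top"
    and H2b: "((\<lambda>x. q' x / (q x)\<^sup>2) \<longlongrightarrow> 0) at_top"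
    (* (H3) *)
    and H3: "\<exists>a>0. \<exists>x0\<ge>0. \<forall>x\<ge>x0. a * q x \<le> Inf (q ` {x..})"
    (* known spectral facts: lam k = lambda_(k+1), psi k = psi_(k+1) *)
    and lam_pos: "0 < lam 0"
    and lam_mono: "strict_mono lam"
    and psi_C2_eig: "\<And>k. \<exists>d1 d2. (\<forall>x\<ge>0. (psi k has_real_derivative d1 x) (at x within {0..})
                                  \<and> (d1 has_real_derivative d2 x) (at x within {0..}))
                        \<and> continuous_on {0..} d2
                        \<and> (\<forall>x\<ge>0. d2 x / 2 - q x * d1 x = - lam k * psi k x)"
    and psi_zero: "\<And>k. psi k 0 = 0"
    and psi_meas: "\<And>k. psi k \<in> borel_measurable borel"
    and psi_orth: "\<And>j k. integrable (mu q) (\<lambda>x. psi j x * psi k x)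
                      \<and> (\<integral>x. psi j x * psi k x \<partial>mu q) = (if j = k then 1 else 0)"
    and psi_complete: "\<And>f. f \<in> borel_measurable borel \<Longrightarrow> integrable (mu q) (\<lambda>x. (f x)\<^sup>2) \<Longrightarrow>
                      (\<forall>k. (\<integral>x. f x * psi k x \<partial>mu q) = 0) \<Longrightarrow> AE x in mu q. f x = 0"
    and psi_bdd: "\<And>k. bounded (psi k ` {0..})"
    and psi_lim: "\<And>k. \<exists>L. (psi k \<longlongrightarrow> L) at_top"
    (* known transition density for finite starting points y > 0 *)
    and density: "\<And>y s A. 0 < y \<Longrightarrow> 0 < s \<Longrightarrow> A \<in> sets borel \<Longrightarrow>
        (\<forall>x\<ge>0. summable (\<lambda>k. exp (- lam k * s) * psi k y * psi k x))
      \<and> set_integrable (mu q) A (rker lam psi s y)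
      \<and> measure M {\<omega> \<in> space M. X y s \<omega> \<in> A \<and> ereal s < hit0 X y \<omega>}
          = (LINT x:A|mu q. rker lam psi s y x)"
    and t_pos: "0 < t"
  shows
    "(\<forall>x\<ge>0. summable (\<lambda>k. exp (- lam k * t) * psi_inf psi k * psi k x))
   \<and> (\<forall>p\<ge>1. ((\<lambda>y. \<integral>\<^sup>+ x. ennreal (\<bar>rker lam psi t y x - rker_inf lam psi t x\<bar> powr p) \<partial>mu q)
               \<longlongrightarrow> 0) at_top)
   \<and> rker_inf lam psi t \<in> borel_measurable borel
   \<and> (\<forall>p\<ge>1. integrable (mu q) (\<lambda>x. \<bar>rker_inf lam psi t x\<bar> powr p))
   \<and> bounded (rker_inf lam psi t ` {0..})
   \<and> continuous_on {0..} (rker_inf lam psi t)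
   \<and> (\<forall>f::real \<Rightarrow> real. f \<in> borel_measurable borel \<longrightarrow> bounded (f ` {0..}) \<longrightarrow>
        (\<integral>\<omega>. indicator {\<omega>. ereal t < Tinf \<omega>} \<omega> * f (Xinf t \<omega>) \<partial>M)
          = (\<integral>x. rker_inf lam psi t x * f x \<partial>mu q))
   \<and> (\<forall>(p::real) (f::real \<Rightarrow> real). 1 \<le> p \<longrightarrow> f \<in> borel_measurable borel \<longrightarrow>
        integrable (mu q) (\<lambda>x. \<bar>f x\<bar> powr p) \<longrightarrow>
        ((\<lambda>z. \<integral>\<omega>. indicator {\<omega>. ereal t < hit0 X z \<omega>} \<omega> * f (X z t \<omega>) \<partial>M)
           \<longlongrightarrow> (\<integral>\<omega>. indicator {\<omega>. ereal t < Tinf \<omega>} \<omega> * f (Xinf t \<omega>) \<partial>M)) at_top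
      \<and> (\<integral>\<omega>. indicator {\<omega>. ereal t < Tinf \<omega>} \<omega> * f (Xinf t \<omega>) \<partial>M)
          = (\<integral>x. rker_inf lam psi t x * f x \<partial>mu q))"
proof -
  interpret prob_space M using BM by (simp add: std_BM_def)
  have "\<exists>d. \<forall>k. (\<forall>x\<ge>0. (psi k has_real_derivative d k x) (at x within {0..})) \<and>
      (\<forall>x\<ge>0. (d k has_real_derivative 2 * q x * d k x - 2 * lam k * psi k x) (at x within {0..}))"
  proof (rule choice, rule allI)
    fix k
    obtain d1 d2 where d: "\<forall>x\<ge>0. (psi k has_real_derivative d1 x) (at x within {0..})
          \<and> (d1 has_real_derivative d2 x) (at x within {0..})"
        "\<forall>x\<ge>0. d2 x / 2 - q x * d1 x = - lam k * psi k x"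
      using psi_C2_eig[of k] by blast
    have "d2 x = 2 * q x * d1 x - 2 * lam k * psi k x" if "0 \<le> x" for x
      using d(2)[rule_format, OF that] by (simp add: field_simps)
    then show "\<exists>d. (\<forall>x\<ge>0. (psi k has_real_derivative d x) (at x within {0..})) \<and>
        (\<forall>x\<ge>0. (d has_real_derivative 2 * q x * d x - 2 * lam k * psi k x) (at x within {0..}))"
      using d(1) by (intro exI[of _ d1]) auto
  qed
  then obtain dpsi where dpsi:
    "\<And>k x. 0 \<le> x \<Longrightarrow> (psi k has_real_derivative dpsi k x) (at x within {0..})"
    "\<And>k x. 0 \<le> x \<Longrightarrow>
      (dpsi k has_real_derivative 2 * q x * dpsi k x - 2 * lam k * psi k x) (at x within {0..})"
    by blast
  have lam_pos: "0 < lam k" for k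
    using lam_pos strict_mono_mono[OF lam_mono, THEN monoD, of 0 k] by simp
  interpret D: entrance_drift q q'
    by (unfold_locales; fact q_deriv q'_cont H1 H2a H2b H3)
  have eig: "bounded_eigenfunction q q' (psi k) (dpsi k) (lam k)" for k
  proof unfold_locales
    show "(\<integral>x. psi k x * psi k x \<partial>mu q) = 1" using psi_orth[of k k] by simp
  qed (fact lam_pos dpsi psi_zero psi_meas psi_bdd)+
  interpret K: killed_diffusion_spectrum q q' psi dpsi lam
    by (intro killed_diffusion_spectrum.intro killed_diffusion_spectrum_axioms.intro;
      fact D.entrance_drift_axioms eig psi_orth psi_lim)
  let ?r = "rker lam psi" and ?rinf = "rker_inf lam psi"

  \<comment> \<open>The killed process from a finite starting point\<close>
  have X_meas' [measurable]: "X y s \<in> borel_measurable M" if "0 < y" for y s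
    using that by (intro X_meas) simp
  have hit: "ereal s < hit0 X y \<omega> \<longleftrightarrow> X y s \<omega> \<noteq> 0"
    if "0 < y" "\<omega> \<in> space M" "0 \<le> s" for y s \<omega>
    using that X_cont[of y \<omega>] X_sde[of y \<omega>] by (intro hit0_gt_iff) auto
  define E where "E s y = {\<omega>\<in>space M. ereal s < hit0 X y \<omega>}" for s y
  have E_eq: "E s y = {\<omega>\<in>space M. X y s \<omega> \<noteq> 0}" if "0 < y" "0 \<le> s" for s y
    using hit that by (auto simp: E_def)
  have E_sets: "E s y \<in> sets M" if "0 < y" "0 \<le> s" for s y
    unfolding E_eq[OF that] using X_meas'[OF that(1), of s] by measurable
  define Einf where "Einf = {\<omega>\<in>space M. ereal t < Tinf \<omega>}"
  have Einf_sets: "Einf \<in> sets M"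
    unfolding Einf_def using Tinf_meas by measurable

  have r_int: "integrable (mu q) (?r s y)" if "0 < s" "0 \<le> y" for s y
    using K.integrable_rker_mult[OF that(1), of "\<lambda>_. 1" y] that by simp
  have rinf_int: "integrable (mu q) (?rinf s)" if "0 < s" for s
    using K.integrable_rker_inf_mult[OF that, of "\<lambda>_. 1"] by simp

  have dens: "measure M {\<omega>\<in>space M. X y s \<omega> \<in> A \<and> \<omega> \<in> E s y} = (\<integral>x. indicator A x * ?r s y x \<partial>mu q)"
    if "0 < y" "0 < s" "A \<in> sets borel" for y s A
  proof -
    have "{\<omega>\<in>space M. X y s \<omega> \<in> A \<and> \<omega> \<in> E s y} = {\<omega>\<in>space M. X y s \<omega> \<in> A \<and> ereal s < hit0 X y \<omega>}"
      by (auto simp: E_def)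
    then show ?thesis using density[OF that] by (simp add: set_lebesgue_integral_def)
  qed
  have r_nonneg: "AE x in mu q. 0 \<le> ?r s y x" if "0 < y" "0 < s" for y s
  proof (rule AE_nonneg_of_integrals)
    show "0 \<le> (\<integral>x. indicator A x * ?r s y x \<partial>mu q)" if "A \<in> sets (mu q)" for A
      using dens[OF \<open>0 < y\<close> \<open>0 < s\<close>, of A, symmetric] that by simp
  qed (use that in \<open>auto intro: r_int\<close>)
  have law: "(\<integral>\<omega>. indicator (E t y) \<omega> * f (X y t \<omega>) \<partial>M) = (\<integral>x. ?r t y x * f x \<partial>mu q)"
    if "0 < y" "f \<in> borel_measurable borel" for y and f :: "real \<Rightarrow> real"
  proof (rule integral_restricted_law)
    show "measure M {\<omega>\<in>space M. c < X y t \<omega> \<and> \<omega> \<in> E t y} = (\<integral>x. indicator {c<..} x * ?r t y x \<partial>mu q)" for c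
      using dens[OF \<open>0 < y\<close> t_pos, of "{c<..}"] by simp
  qed (use that t_pos in \<open>auto intro: r_int r_nonneg E_sets X_meas finite_measure_axioms\<close>)

  \<comment> \<open>Passage to the starting point infinity\<close>
  define z where "z n = 1 + real n" for n
  \<comment> \<open>Positivity is what \<open>density\<close> asks for. A sequence is used because
    dominated convergence is sequential and exceptional null sets may be united only countably
    often.\<close>
  have z_pos: "0 < z n" for n by (simp add: z_def)
  have z_lim: "filterlim z at_top sequentially"
    unfolding z_def by (intro filterlim_tendsto_add_at_top[OF tendsto_const] filterlim_real_sequentially)

  have ne: "AE \<omega> in M. Tinf \<omega> \<noteq> ereal t"
  proof (rule AE_limit_time_neq[where \<tau> = "\<lambda>n. hit0 X (z n)" and g = "\<lambda>s. \<integral>x. ?rinf s x \<partial>mu q"])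
    show "{\<omega>\<in>space M. ereal s < hit0 X (z n) \<omega>} \<in> sets M" if "0 \<le> s" for n s
      using E_sets[OF z_pos that] by (simp add: E_def)
    show "AE \<omega> in M. (\<lambda>n. hit0 X (z n) \<omega>) \<longlonglongrightarrow> Tinf \<omega>"
      using Tinf_lim by eventually_elim (rule filterlim_compose[OF _ z_lim])
    show "(\<lambda>n. measure M {\<omega>\<in>space M. ereal s < hit0 X (z n) \<omega>}) \<longlonglongrightarrow> (\<integral>x. ?rinf s x \<partial>mu q)"
      if "0 < s" for s
    proof -
      have "measure M {\<omega>\<in>space M. ereal s < hit0 X (z n) \<omega>} = (\<integral>x. ?r s (z n) x * 1 \<partial>mu q)" for n
        using dens[OF z_pos that, of UNIV n] by (simp add: E_def)
      moreover have "(\<lambda>n. \<integral>x. ?r s (z n) x * 1 \<partial>mu q) \<longlonglongrightarrow> (\<integral>x. ?rinf s x * 1 \<partial>mu q)"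
        by (rule filterlim_compose[OF K.integral_rker_tendsto[OF that] z_lim]) simp
      ultimately show ?thesis by simp
    qed
  qed (fact Tinf_meas t_pos finite_measure_axioms K.isCont_integral_rker_inf[OF t_pos])+

  have law_inf_Ioi: "measure M {\<omega>\<in>space M. c < Xinf t \<omega> \<and> \<omega> \<in> Einf}
      = (\<integral>x. indicator {c<..} x * ?rinf t x \<partial>mu q)" for c
  proof (rule restricted_law_limit[where Y = "\<lambda>n. X (z n) t" and E = "\<lambda>n. E t (z n)" and r = "\<lambda>n. ?r t (z n)"])
    show "AE \<omega> in M. (\<lambda>n. X (z n) t \<omega>) \<longlonglongrightarrow> Xinf t \<omega>"
      using Xinf_lim[OF t_pos] by eventually_elim (rule filterlim_compose[OF _ z_lim])
    \<comment> \<open>Away from the null event that \<open>Tinf\<close> equals t, strict inequality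
      on either side is inherited by the approximating hitting times, so the survival indicators
      become constant.\<close>
    show "AE \<omega> in M. eventually (\<lambda>n. \<omega> \<in> E t (z n) \<longleftrightarrow> \<omega> \<in> Einf) sequentially"
      using Tinf_lim ne AE_space
    proof eventually_elim
      case (elim \<omega>)
      have lim: "(\<lambda>n. hit0 X (z n) \<omega>) \<longlonglongrightarrow> Tinf \<omega>" by (rule filterlim_compose[OF elim(1) z_lim])
      consider "ereal t < Tinf \<omega>" | "Tinf \<omega> < ereal t" using elim(2) by fastforce
      then show ?case
      proof cases
        case 1
        with order_tendstoD(1)[OF lim 1] show ?thesis
          using elim(3) by (auto simp: E_def Einf_def elim!: eventually_mono)
      next
        case 2
        with order_tendstoD(2)[OF lim 2] show ?thesis
          using elim(3) by (auto simp: E_def Einf_def elim!: eventually_mono)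
      qed
    qed
    show "(\<lambda>n. \<integral>x. ?r t (z n) x * f x \<partial>mu q) \<longlonglongrightarrow> (\<integral>x. ?rinf t x * f x \<partial>mu q)"
      if f: "f \<in> borel_measurable borel" "bounded (range f)" for f
    proof (rule filterlim_compose[OF K.integral_rker_tendsto[OF t_pos] z_lim])
      obtain C where "\<And>x. norm (f x) \<le> C" using f(2) unfolding bounded_iff by blast
      then show "integrable (mu q) f"
        using f(1) by (intro D.integrable_const_bound[where B = C]) auto
    qed
  qed (use t_pos z_pos Xinf_meas Einf_sets in
      \<open>auto intro: finite_measure_axioms rinf_int law E_sets X_meas'\<close>)
  have rinf_nonneg: "AE x in mu q. 0 \<le> ?rinf t x"
  proof -
    \<comment> \<open>Nonnegativity passes to the limit kernel outside a single null set common to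
      all n.\<close>
    have "AE x in mu q. \<forall>n. 0 \<le> ?r t (z n) x"
      unfolding AE_all_countable by (intro allI r_nonneg z_pos t_pos)
    then show ?thesis
      using D.AE_mu_nonneg
    proof eventually_elim
      case (elim x)
      obtain \<delta> where \<delta>: "(\<delta> \<longlongrightarrow> 0) at_top"
        "eventually (\<lambda>y. \<forall>x\<in>{0..}. \<bar>?r t y x - ?rinf t x\<bar> \<le> \<delta> y) at_top"
        using K.rker_uniform_tendsto[OF t_pos] by blast
      have "((\<lambda>y. ?r t y x) \<longlongrightarrow> ?rinf t x) at_top"
        by (rule LIM_zero_cancel, rule Lim_null_comparison[OF _ \<delta>(1)])
          (use \<delta>(2) elim(2) in \<open>auto elim!: eventually_mono\<close>)
      from filterlim_compose[OF this z_lim] show ?case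
        by (rule LIMSEQ_le_const) (use elim(1) in auto)
    qed
  qed
  have law_inf: "(\<integral>\<omega>. indicator {\<omega>. ereal t < Tinf \<omega>} \<omega> * f (Xinf t \<omega>) \<partial>M) = (\<integral>x. ?rinf t x * f x \<partial>mu q)"
    if "f \<in> borel_measurable borel" for f :: "real \<Rightarrow> real"
  proof -
    have "(\<integral>\<omega>. indicator {\<omega>. ereal t < Tinf \<omega>} \<omega> * f (Xinf t \<omega>) \<partial>M)
        = (\<integral>\<omega>. indicator Einf \<omega> * f (Xinf t \<omega>) \<partial>M)"
      by (intro Bochner_Integration.integral_cong) (auto simp: Einf_def split: split_indicator)
    also have "\<dots> = (\<integral>x. ?rinf t x * f x \<partial>mu q)"
      by (rule integral_restricted_law[OF finite_measure_axioms Xinf_meas Einf_sets D.sets_mu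
            rinf_int[OF t_pos] rinf_nonneg law_inf_Ioi that])
    finally show ?thesis .
  qed
  have law_lim: "((\<lambda>y. \<integral>\<omega>. indicator {\<omega>. ereal t < hit0 X y \<omega>} \<omega> * f (X y t \<omega>) \<partial>M)
      \<longlongrightarrow> (\<integral>x. ?rinf t x * f x \<partial>mu q)) at_top"
    if f: "f \<in> borel_measurable borel" and "integrable (mu q) (\<lambda>x. \<bar>f x\<bar> powr p)" "1 \<le> p"
    for p and f :: "real \<Rightarrow> real"
  proof -
    \<comment> \<open>Since |f| <= 1 + |f|^p and \<open>mu q\<close> is finite, the L^p case reduces
      to L^1, where uniform convergence of the kernels is enough. This limit is along all real
      starting points, no longer along the sequence.\<close>
    have "integrable (mu q) f"
    proof (rule Bochner_Integration.integrable_bound)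
      show "integrable (mu q) (\<lambda>x. 1 + \<bar>f x\<bar> powr p)" using that(2) by simp
      show "AE x in mu q. norm (f x) \<le> norm (1 + \<bar>f x\<bar> powr p)"
      proof (intro AE_I2)
        fix x
        show "norm (f x) \<le> norm (1 + \<bar>f x\<bar> powr p)"
        proof (cases "\<bar>f x\<bar> \<le> 1")
          case False
          then have "\<bar>f x\<bar> powr 1 \<le> \<bar>f x\<bar> powr p" using \<open>1 \<le> p\<close> by (intro powr_mono) auto
          then show ?thesis using False by simp
        qed (simp add: add_increasing2)
      qed
    qed (use f in simp)
    then have "((\<lambda>y. \<integral>x. ?r t y x * f x \<partial>mu q) \<longlongrightarrow> (\<integral>x. ?rinf t x * f x \<partial>mu q)) at_top"
      by (rule K.integral_rker_tendsto[OF t_pos])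
    moreover have "eventually (\<lambda>y. (\<integral>x. ?r t y x * f x \<partial>mu q)
        = (\<integral>\<omega>. indicator {\<omega>. ereal t < hit0 X y \<omega>} \<omega> * f (X y t \<omega>) \<partial>M)) at_top"
      using eventually_gt_at_top[of 0]
    proof eventually_elim
      case (elim y)
      have "(\<integral>\<omega>. indicator {\<omega>. ereal t < hit0 X y \<omega>} \<omega> * f (X y t \<omega>) \<partial>M)
          = (\<integral>\<omega>. indicator (E t y) \<omega> * f (X y t \<omega>) \<partial>M)"
        by (intro Bochner_Integration.integral_cong) (auto simp: E_def split: split_indicator)
      then show ?case using law[OF elim f] by simp
    qed
    ultimately show ?thesis by (rule Lim_transform_eventually)
  qed
  have bdd: "bounded (?rinf t ` {0..})"
  proof -
    obtain C where C: "\<And>x. 0 \<le> x \<Longrightarrow> \<bar>?rinf t x\<bar> \<le> C"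
      "\<And>x y. 0 \<le> x \<Longrightarrow> 0 \<le> y \<Longrightarrow> \<bar>?r t y x\<bar> \<le> C"
      using K.kernels_bounded[OF t_pos] by blast
    then show ?thesis unfolding bounded_iff by (intro exI[of _ C]) (auto intro: C(1))
  qed
  show ?thesis
  proof (intro conjI allI impI)
    show "summable (\<lambda>k. exp (- lam k * t) * psi_inf psi k * psi k x)" if "0 \<le> x" for x
      by (rule K.rker_inf_summable[OF t_pos that])
    show "((\<lambda>y. \<integral>\<^sup>+ x. ennreal (\<bar>?r t y x - ?rinf t x\<bar> powr p) \<partial>mu q) \<longlongrightarrow> 0) at_top" if "1 \<le> p" for p
      by (rule K.rker_Lp_tendsto[OF t_pos that])
    show "integrable (mu q) (\<lambda>x. \<bar>?rinf t x\<bar> powr p)" if "1 \<le> p" for p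
      by (rule K.integrable_rker_inf_powr[OF t_pos that])
    show "?rinf t \<in> borel_measurable borel" by (rule K.rker_inf_measurable)
    show "continuous_on {0..} (?rinf t)" by (rule K.rker_inf_cont[OF t_pos])
    show "((\<lambda>y. \<integral>\<omega>. indicator {\<omega>. ereal t < hit0 X y \<omega>} \<omega> * f (X y t \<omega>) \<partial>M)
        \<longlongrightarrow> (\<integral>\<omega>. indicator {\<omega>. ereal t < Tinf \<omega>} \<omega> * f (Xinf t \<omega>) \<partial>M)) at_top"
      if "1 \<le> p" "f \<in> borel_measurable borel" "integrable (mu q) (\<lambda>x. \<bar>f x\<bar> powr p)"
      for p and f :: "real \<Rightarrow> real"
      unfolding law_inf[OF that(2)] by (rule law_lim[OF that(2,3,1)])
  qed (rule bdd law_inf; assumption)+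
qed

end
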